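(* Let $p:\mathbb{R}^n\to\mathbb{R}$ be a bounded measurable function with $p^->1$. If the Hardy--Littlewood maximal operator $\mathcal{M}: L^{p(\cdot)}(\mathbb{R}^n)\to L^{p(\cdot)}(\mathbb{R}^n)$ is bounded, then $\mathcal{M}: w\text{-}L^{p(\cdot)}(\mathbb{R}^n)\to w\text{-}L^{p(\cdot)}(\mathbb{R}^n)$ is bounded. In particular, $\mathcal{M}: w\text{-}L^{p(\cdot)}(\mathbb{R}^n)\to w\text{-}L^{p(\cdot)}(\mathbb{R}^n)$ is bounded when $p$ is $\log$-Hölder continuous and $p^->1$.
   Context: Notation: $p^-:=\operatorname{ess\,inf}_{\mathbb{R}^n}p$. $L^{p(\cdot)}(\mathbb{R}^n)$ is the set of measurable $f$ with $\int_{\mathbb{R}^n}|f(x)|^{p(x)}dx<\infty$, with Luxemburg norm $\|f\|_{L^{p(\cdot)}}:=\inf\{\lambda>0:\int|f(x)/\lambda|^{p(x)}dx\le 1\}$. The weak Lebesgue space $w\text{-}L^{p(\cdot)}(\mathbb{R}^n)$ consists of the measurable $f$ with $\|f\|_{w\text{-}L^{p(\cdot)}}:=\sup_{\lambda>0}\lambda\|\chi_{\{|f|>\lambda\}}\|_{L^{p(\cdot)}}<\infty$. An operator $T$ is bounded from $X$ to $X$ if there is a constant $C$ with $\|Tf\|_X\le C\|f\|_X$ for all $f\in X$. Maximal operator: $\mathcal{M}f(x):=\sup_{t>0}\frac1{|B(x,t)|}\int_{B(x,t)}|f(y)|\,dy$. $p$ is $\log$-Hölder continuous on $\mathbb{R}^n$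 if there are $c,c'>0$ and $p_\infty\ge 1$ such that $|p(x)-p(y)|\le \frac{c}{\log(e+1/|x-y|)}$ for all $x,y$ and $|p(x)-p_\infty|\le\frac{c'}{\log(e+|x|)}$ for all $x$. *)

theory Defs
  imports "HOL-Analysis.Analysis" "HOL-Probability.Essential_Supremum"
begin

text \<open>
  Functions on Euclidean space take extended real values, so that the maximal function,
  which may be infinite somewhere, has the same type as its argument. A member of either
  function space below is finite almost everywhere when the exponent is positive and bounded.
\<close>

text \<open>
  \<open>abs_powr y r\<close> is \<open>\<bar>y\<bar>\<close> to the power \<open>r\<close> for \<open>r > 0\<close>. Its values for \<open>r \<le> 0\<close> are
  immaterial for exponents with \<open>p_minus p > 1\<close>, since these are positive almost everywhere.
\<close>

definition abs_powr :: "ereal \<Rightarrow> real \<Rightarrow> ennreal" where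
  "abs_powr y r = (if \<bar>y\<bar> = \<infinity> then \<infinity> else ennreal (\<bar>real_of_ereal y\<bar> powr r))"

definition p_minus :: "(real^'n \<Rightarrow> real) \<Rightarrow> ereal" where
  "p_minus p = - esssup lebesgue (\<lambda>x. - ereal (p x))"

definition modular :: "(real^'n \<Rightarrow> real) \<Rightarrow> (real^'n \<Rightarrow> ereal) \<Rightarrow> ennreal" where
  "modular p f = (\<integral>\<^sup>+x. abs_powr (f x) (p x) \<partial>lebesgue)"

definition Lp :: "(real^'n \<Rightarrow> real) \<Rightarrow> (real^'n \<Rightarrow> ereal) set" where
  "Lp p = {f \<in> borel_measurable lebesgue. modular p f < \<infinity>}"

text \<open>An empty infimum is \<open>\<infinity>\<close>.\<close>

definition Lp_norm :: "(real^'n \<Rightarrow> real) \<Rightarrow> (real^'n \<Rightarrow> ereal) \<Rightarrow> ennreal" where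
  "Lp_norm p f = Inf {ennreal l |l::real. l > 0 \<and> modular p (\<lambda>x. f x / ereal l) \<le> 1}"

definition weak_Lp_norm :: "(real^'n \<Rightarrow> real) \<Rightarrow> (real^'n \<Rightarrow> ereal) \<Rightarrow> ennreal" where
  "weak_Lp_norm p f =
     (SUP l\<in>{0::real<..}. ennreal l * Lp_norm p (indicator {x. \<bar>f x\<bar> > ereal l}))"

definition weak_Lp :: "(real^'n \<Rightarrow> real) \<Rightarrow> (real^'n \<Rightarrow> ereal) set" where
  "weak_Lp p = {f \<in> borel_measurable lebesgue. weak_Lp_norm p f < \<infinity>}"

definition maximal_op :: "(real^'n \<Rightarrow> ereal) \<Rightarrow> real^'n \<Rightarrow> ereal" where
  "maximal_op f x = enn2ereal
     (SUP t\<in>{0::real<..}.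
        (\<integral>\<^sup>+y\<in>ball x t. e2ennreal \<bar>f y\<bar> \<partial>lebesgue) / emeasure lebesgue (ball x t))"

definition bounded_operator_on ::
  "(real^'n \<Rightarrow> ereal) set \<Rightarrow> ((real^'n \<Rightarrow> ereal) \<Rightarrow> ennreal) \<Rightarrow>
   ((real^'n \<Rightarrow> ereal) \<Rightarrow> (real^'n \<Rightarrow> ereal)) \<Rightarrow> bool" where
  "bounded_operator_on X N T \<longleftrightarrow>
     (\<exists>C::real. C \<ge> 0 \<and> (\<forall>f\<in>X. T f \<in> X \<and> N (T f) \<le> ennreal C * N f))"

text \<open>For \<open>x = y\<close> the convention \<open>1 / 0 = 0\<close> makes the first inequality trivially true.\<close>

definition log_Holder :: "(real^'n \<Rightarrow> real) \<Rightarrow> bool" where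
  "log_Holder p \<longleftrightarrow>
     (\<exists>c c' p_inf::real. c > 0 \<and> c' > 0 \<and> p_inf \<ge> 1 \<and>
        (\<forall>x y. \<bar>p x - p y\<bar> \<le> c / ln (exp 1 + 1 / norm (x - y))) \<and>
        (\<forall>x. \<bar>p x - p_inf\<bar> \<le> c' / ln (exp 1 + norm x)))"

end

theory Submission
  imports Defs
begin

text \<open>
  Write \<open>M\<close> for the maximal operator. Let \<open>f\<close> have weak norm \<open>1\<close>, let \<open>D > 1\<close>, and let \<open>E k\<close> be the set where
  \<open>\<bar>f\<bar>\<close> exceeds \<open>D ^ k * l / 2\<close>. Cutting \<open>f\<close> into layers gives
  \<open>M f \<le> l / 2 + (\<Sum>k. D ^ (k + 1) * l / 2 * M (indicator (E k)))\<close>, so that \<open>M f > l\<close> forces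
  \<open>M (indicator (E k)) > t k\<close> for some \<open>k\<close>, where \<open>t k = 1 / (D ^ (k + 1) * (k + 1) * (k + 2))\<close>; the last two
  factors make the weights \<open>D ^ (k + 1) * t k\<close> sum to \<open>1\<close>. The weak norm bounds the norm of
  \<open>indicator (E k)\<close> by a multiple of \<open>1 / (D ^ k * l)\<close>. Hence everything follows once the passage from a
  set \<open>E\<close> to the set where \<open>M (indicator E) > t k\<close> multiplies the norm of the indicator by at most a multiple
  of \<open>D ^ k / (k + 1) ^ 2\<close>: the resulting series converges (lemma \<open>bounded_weak_Lp_if_restricted\<close>).

  Boundedness of \<open>M\<close> on the strong space alone gives the factor \<open>1 / t k\<close>, which is too large by the fourth
  power of \<open>k\<close>. The missing decay is a self-improvement obtained by iterating \<open>M\<close>, which costs only a power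
  of the operator norm. By a reverse weak-type inequality (lemma \<open>reverse_weak_type\<close>) each further
  application of \<open>M\<close> to an indicator gains a logarithm: where \<open>M (indicator E) > t\<close>, the iterate of order
  \<open>j + 2\<close> is at least of the order of \<open>t * ln (1 / s) ^ j\<close> or exceeds \<open>s\<close>, for any small level \<open>s\<close>
  (lemma \<open>HL_iterate_ge_log_gain\<close>). For \<open>t = t k\<close> and \<open>s\<close> the square root of \<open>1 / D ^ k\<close>, the logarithm is
  comparable with \<open>k\<close> and \<open>s\<close> is much larger than \<open>t\<close>, so six iterations are enough.

  For a log-Hoelder continuous exponent the restricted estimate is proved directly, with the better factor
  \<open>t powr (- 1 / r)\<close> for some \<open>1 < r < p_minus p\<close>. If \<open>l\<close> is admissible in the Luxemburg norm of
  \<open>indicator E\<close> and \<open>L = l * t powr (- 1 / r)\<close>, one has to bound the integral of \<open>L powr - p x\<close> over the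
  superlevel set. For \<open>L \<le> 1\<close> the local modulus of continuity makes \<open>L powr - p x\<close> essentially constant
  on each ball of a Vitali covering; for \<open>L \<ge> 1\<close> the decay condition at infinity makes it essentially
  constant outside a ball around the origin that is too small to matter
  (lemmas \<open>exponent_integral_superlevel_small\<close> and \<open>exponent_integral_superlevel_large\<close>).
\<close>

section \<open>The Hardy--Littlewood maximal function\<close>

(* Otherwise the simplifier moves the measures of balls from lebesgue to lborel. *)
declare emeasure_completion [simp del]

lemma ball_in_sets_lebesgue [measurable]:
  fixes x :: "'a::euclidean_space"
  shows "ball x r \<in> sets lebesgue"
  by auto

text \<open>
  The maximal operator on functions with values in \<open>ennreal\<close>, which can be iterated and integrated without
  conversions.
\<close>

definition HL :: "('a::euclidean_space \<Rightarrow> ennreal) \<Rightarrow> 'a \<Rightarrow> ennreal" where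
  "HL f x = (SUP t\<in>{0::real<..}.
     (\<integral>\<^sup>+y\<in>ball x t. f y \<partial>lebesgue) / emeasure lebesgue (ball x t))"

lemma emeasure_lebesgue_ball:
  fixes x :: "'a::euclidean_space"
  assumes "0 \<le> r"
  shows "emeasure lebesgue (ball x r) = ennreal (unit_ball_vol (real DIM('a)) * r ^ DIM('a))"
  using emeasure_ball[OF assms, of x] by (simp add: emeasure_completion)

lemma emeasure_lebesgue_ball_pos:
  fixes x :: "'a::euclidean_space"
  assumes "0 < r"
  shows "0 < emeasure lebesgue (ball x r)"
  using assms by (simp add: emeasure_lebesgue_ball ennreal_zero_less_mult_iff)

lemma emeasure_lebesgue_ball_finite:
  fixes x :: "'a::euclidean_space"
  shows "emeasure lebesgue (ball x r) < top"
  by (cases "r \<ge> 0") (simp_all add: emeasure_lebesgue_ball ball_empty)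

lemma emeasure_lebesgue_ball_scale:
  fixes x y :: "'a::euclidean_space"
  assumes "0 \<le> r" "0 \<le> s"
  shows "emeasure lebesgue (ball x (s * r)) = ennreal (s ^ DIM('a)) * emeasure lebesgue (ball y r)"
  using assms
  by (simp add: emeasure_lebesgue_ball power_mult_distrib ennreal_mult[symmetric] mult_ac)

lemma ennreal_divide_mult_cancel:
  fixes a b :: ennreal
  assumes "0 < b" "b < top"
  shows "a / b * b = a"
  using assms by (simp add: ennreal_divide_times ennreal_times_divide mult_divide_eq_ennreal)

lemma ennreal_divide_le_iff:
  fixes a b c :: ennreal
  assumes "0 < b" "b < top"
  shows "a / b \<le> c \<longleftrightarrow> a \<le> c * b"
proof
  assume "a / b \<le> c"
  then have "a / b * b \<le> c * b" by (rule mult_right_mono) simp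
  then show "a \<le> c * b" using assms by (simp add: ennreal_divide_mult_cancel)
next
  assume "a \<le> c * b"
  then have "a / b \<le> (c * b) / b" by (rule divide_right_mono_ennreal)
  then show "a / b \<le> c" using assms by (simp add: mult_divide_eq_ennreal)
qed

lemma HL_le_iff:
  "HL f x \<le> c \<longleftrightarrow>
    (\<forall>t>0. (\<integral>\<^sup>+y\<in>ball x t. f y \<partial>lebesgue) \<le> c * emeasure lebesgue (ball x t))"
  unfolding HL_def SUP_le_iff
  by (auto simp: ennreal_divide_le_iff emeasure_lebesgue_ball_pos emeasure_lebesgue_ball_finite)

lemma less_HL_iff:
  "c < HL f x \<longleftrightarrow>
    (\<exists>t>0. c * emeasure lebesgue (ball x t) < (\<integral>\<^sup>+y\<in>ball x t. f y \<partial>lebesgue))"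
  using HL_le_iff[of f x c] by (auto simp: not_le[symmetric])

lemma set_nn_integral_ball_le_HL:
  assumes "0 < t"
  shows "(\<integral>\<^sup>+y\<in>ball x t. f y \<partial>lebesgue) \<le> HL f x * emeasure lebesgue (ball x t)"
  using HL_le_iff[of f x "HL f x"] assms by simp

lemma HL_mono: "(\<And>y. f y \<le> g y) \<Longrightarrow> HL f x \<le> HL g x"
  unfolding HL_le_iff
  by (intro allI impI order_trans[OF nn_integral_mono set_nn_integral_ball_le_HL] mult_right_mono)
     auto

lemma HL_mono_AE:
  assumes "AE y in lebesgue. f y \<le> g y"
  shows "HL f x \<le> HL g x"
  unfolding HL_le_iff
proof (intro allI impI order_trans[OF nn_integral_mono_AE set_nn_integral_ball_le_HL])
  fix t :: real
  show "AE y in lebesgue. f y * indicator (ball x t) y \<le> g y * indicator (ball x t) y"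
    using assms by eventually_elim (rule mult_right_mono, auto)
qed

text \<open>
  An average over \<open>ball x t\<close> exceeding \<open>c\<close> still does so after replacing the ball by a slightly smaller
  concentric one in the integral, and the smaller ball lies in \<open>ball y t\<close> for all \<open>y\<close> close to \<open>x\<close>.
\<close>

lemma open_HL_superlevel:
  fixes f :: "'a::euclidean_space \<Rightarrow> ennreal"
  assumes f: "f \<in> borel_measurable lebesgue"
  shows "open {x. c < HL f x}"
proof (unfold open_contains_ball, intro ballI)
  fix x assume "x \<in> {x. c < HL f x}"
  then obtain t where t: "t > 0"
    "c * emeasure lebesgue (ball x t) < (\<integral>\<^sup>+y\<in>ball x t. f y \<partial>lebesgue)"
    by (auto simp: less_HL_iff)
  define s where "s i = t - t / real (Suc i)" for i :: nat
  have s_mono: "incseq s"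
    using t(1) by (auto simp: incseq_def s_def intro!: divide_left_mono)
  have un: "(\<Union>i. ball x (s i)) = ball x t"
  proof (intro equalityI subsetI)
    fix y assume y: "y \<in> ball x t"
    then have "0 < (t - dist x y) / t" using t(1) by simp
    then obtain i where "inverse (real (Suc i)) < (t - dist x y) / t"
      using reals_Archimedean by blast
    then have "t / real (Suc i) < t - dist x y" using t(1)
      by (simp add: field_simps)
    then show "y \<in> (\<Union>i. ball x (s i))" by (auto simp: s_def intro!: exI[of _ i])
  next
    fix y assume "y \<in> (\<Union>i. ball x (s i))"
    then obtain i where "dist x y < t - t / real (Suc i)" by (auto simp: s_def)
    moreover have "0 \<le> t / real (Suc i)" using t(1) by simp
    ultimately show "y \<in> ball x t" by (simp add: mem_ball)
  qed
  have "(\<integral>\<^sup>+y\<in>ball x t. f y \<partial>lebesgue) = emeasure (density lebesgue f) (\<Union>i. ball x (s i))"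
    using f by (simp add: emeasure_density un)
  also have "\<dots> = (SUP i. emeasure (density lebesgue f) (ball x (s i)))"
    by (rule SUP_emeasure_incseq[symmetric]) (use s_mono in \<open>auto simp: incseq_def intro!: subset_ball\<close>)
  finally obtain i where i: "c * emeasure lebesgue (ball x t) < emeasure (density lebesgue f) (ball x (s i))"
    using t(2) by (auto simp: less_SUP_iff)
  show "\<exists>e>0. ball x e \<subseteq> {x. c < HL f x}"
  proof (intro exI conjI subsetI)
    show "t - s i > 0" using t(1) by (simp add: s_def)
    fix y assume y: "y \<in> ball x (t - s i)"
    have "ball x (s i) \<subseteq> ball y t"
      using y by (intro ball_subset_ball_iff[THEN iffD2]) (auto simp: dist_commute)
    then have "emeasure (density lebesgue f) (ball x (s i)) \<le> emeasure (density lebesgue f) (ball y t)"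
      by (intro emeasure_mono) auto
    also have "\<dots> = (\<integral>\<^sup>+z\<in>ball y t. f z \<partial>lebesgue)"
      using f by (simp add: emeasure_density)
    finally have "c * emeasure lebesgue (ball x t) < (\<integral>\<^sup>+z\<in>ball y t. f z \<partial>lebesgue)"
      using i by (rule less_le_trans[rotated])
    moreover have "emeasure lebesgue (ball x t) = emeasure lebesgue (ball y t)"
      using t(1) by (simp add: emeasure_lebesgue_ball)
    ultimately show "y \<in> {x. c < HL f x}" using t(1) by (auto simp: less_HL_iff)
  qed
qed

lemma borel_measurable_HL:
  fixes f :: "'a::euclidean_space \<Rightarrow> ennreal"
  assumes "f \<in> borel_measurable lebesgue"
  shows "HL f \<in> borel_measurable lebesgue"
  by (rule borel_measurableI_greater)
     (use open_HL_superlevel[OF assms] in \<open>auto simp: borel_open\<close>)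

lemma set_nn_integral_Union_le:
  assumes "countable C" "\<And>i. i \<in> C \<Longrightarrow> S i \<in> sets M" "f \<in> borel_measurable M"
    "A \<subseteq> (\<Union>i\<in>C. S i)"
  shows "(\<integral>\<^sup>+x\<in>A. f x \<partial>M) \<le> (\<integral>\<^sup>+i. (\<integral>\<^sup>+x\<in>S i. f x \<partial>M) \<partial>count_space C)"
proof -
  have "(\<integral>\<^sup>+x\<in>A. f x \<partial>M) \<le> (\<integral>\<^sup>+x. (\<integral>\<^sup>+i. f x * indicator (S i) x \<partial>count_space C) \<partial>M)"
  proof (rule nn_integral_mono)
    fix x
    show "f x * indicator A x \<le> (\<integral>\<^sup>+i. f x * indicator (S i) x \<partial>count_space C)"
    proof (cases "x \<in> A")
      case True
      then obtain j where j: "j \<in> C" "x \<in> S j" using assms(4) by auto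
      have "f x * indicator A x = f x * indicator (S j) x" using j True by simp
      also have "\<dots> \<le> (\<integral>\<^sup>+i. f x * indicator (S i) x \<partial>count_space C)"
        using j(1) by (rule nn_integral_ge_point)
      finally show ?thesis .
    qed simp
  qed
  also have "\<dots> = (\<integral>\<^sup>+i. (\<integral>\<^sup>+x\<in>S i. f x \<partial>M) \<partial>count_space C)"
    by (rule nn_integral_count_space_nn_integral) (use assms in auto)
  finally show ?thesis .
qed


lemma nn_integral_disjoint_Union_sets:
  assumes "countable C" "\<And>i. i \<in> C \<Longrightarrow> S i \<in> sets M" "pairwise (\<lambda>i j. disjnt (S i) (S j)) C"
  shows "(\<integral>\<^sup>+i. emeasure M (S i) \<partial>count_space C) = emeasure M (\<Union>i\<in>C. S i)"
  using assms
  by (intro emeasure_UN_countable[symmetric])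
     (auto simp: disjoint_family_on_def pairwise_def disjnt_def)

text \<open>
  The half of Lebesgue's differentiation theorem that is needed. On a set of finite measure where
  \<open>HL f \<le> a < b < f\<close>, every ball centred in the set has \<open>f\<close>-mass at most \<open>a\<close> times its volume. Covering the set
  up to a null set by disjoint such balls inside a tight open neighbourhood bounds \<open>b\<close> times its measure by
  \<open>a\<close> times its measure, so it is null.
\<close>

lemma AE_le_HL:
  fixes f :: "'a::euclidean_space \<Rightarrow> ennreal"
  assumes f: "f \<in> borel_measurable lebesgue"
  shows "AE x in lebesgue. f x \<le> HL f x"
proof -
  have HLm [measurable]: "HL f \<in> borel_measurable lebesgue" by (rule borel_measurable_HL[OF f])
  note f [measurable]
  define N where "N a b k = {x. HL f x \<le> ennreal a \<and> ennreal b < f x \<and> x \<in> ball 0 (real k)}"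
    for a b :: real and k :: nat
  have N0: "N a b k \<in> null_sets lebesgue" if ab: "0 \<le> a" "a < b" for a b k
  proof -
    have Nm: "N a b k \<in> sets lebesgue"
    proof -
      have "N a b k = {x\<in>space lebesgue. HL f x \<le> ennreal a \<and> ennreal b < f x} \<inter> ball 0 (real k)"
        by (auto simp: N_def)
      also have "\<dots> \<in> sets lebesgue" by measurable
      finally show ?thesis .
    qed
    have "emeasure lebesgue (N a b k) \<le> emeasure lebesgue (ball (0::'a) (real k))"
      by (rule emeasure_mono) (auto simp: N_def)
    then have fin: "emeasure lebesgue (N a b k) < top"
      using emeasure_lebesgue_ball_finite by (rule le_less_trans)
    have key: "ennreal b * emeasure lebesgue (N a b k) \<le> ennreal a * emeasure lebesgue (N a b k) + ennreal (a * e)"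
      if e: "e > 0" for e :: real
    proof -
      obtain U where U: "open U" "N a b k \<subseteq> U" "emeasure lebesgue (U - N a b k) < ennreal e"
        using sets_lebesgue_outer_open[OF Nm e] by metis
      define K where "K = {(x, r). x \<in> N a b k \<and> 0 < r \<and> ball x r \<subseteq> U}"
      have fine: "\<exists>i. i \<in> K \<and> x \<in> ball (fst i) (snd i) \<and> snd i < d"
        if x: "x \<in> N a b k" and d: "0 < d" for x d
      proof -
        obtain r where r: "r > 0" "ball x r \<subseteq> U"
          using U(1,2) x openE by blast
        have "ball x (min r (d/2)) \<subseteq> U" using r by (meson min.cobounded1 order.trans subset_ball)
        then show ?thesis using x d r
          by (intro exI[of _ "(x, min r (d/2))"]) (auto simp: K_def)
      qed
      obtain C where C: "countable C" "C \<subseteq> K"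
        "pairwise (\<lambda>i j. disjnt (ball (fst i) (snd i)) (ball (fst j) (snd j))) C"
        "negligible (N a b k - (\<Union>i\<in>C. ball (fst i) (snd i)))"
        using Vitali_covering_theorem_balls[OF fine] by blast
      let ?W = "\<Union>i\<in>C. ball (fst i) (snd i)"
      have Wm: "?W \<in> sets lebesgue" using C(1) by (intro sets.countable_UN') auto
      have "ennreal b * emeasure lebesgue (N a b k) = (\<integral>\<^sup>+x\<in>N a b k. ennreal b \<partial>lebesgue)"
        using Nm by (simp add: nn_integral_cmult_indicator)
      also have "\<dots> \<le> (\<integral>\<^sup>+x\<in>?W. f x \<partial>lebesgue)"
      proof (rule nn_integral_mono_AE)
        have "AE x in lebesgue. x \<notin> N a b k - ?W"
          using C(4) by (intro AE_not_in) (simp add: negligible_iff_null_sets)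
        then show "AE x in lebesgue. ennreal b * indicator (N a b k) x \<le> f x * indicator ?W x"
          by eventually_elim (auto simp: N_def indicator_def)
      qed
      also have "\<dots> \<le> (\<integral>\<^sup>+i. (\<integral>\<^sup>+x\<in>ball (fst i) (snd i). f x \<partial>lebesgue) \<partial>count_space C)"
        by (rule set_nn_integral_Union_le[OF C(1) _ f order_refl]) auto
      also have "\<dots> \<le> (\<integral>\<^sup>+i. ennreal a * emeasure lebesgue (ball (fst i) (snd i)) \<partial>count_space C)"
      proof (rule nn_integral_mono)
        fix i assume "i \<in> space (count_space C)"
        then have i: "fst i \<in> N a b k" "snd i > 0" using C(2) by (auto simp: K_def)
        show "(\<integral>\<^sup>+x\<in>ball (fst i) (snd i). f x \<partial>lebesgue) \<le> ennreal a * emeasure lebesgue (ball (fst i) (snd i))"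
          using set_nn_integral_ball_le_HL[OF i(2), of f "fst i"] i(1)
          by (elim order_trans) (auto simp: N_def intro!: mult_right_mono)
      qed
      also have "\<dots> = ennreal a * (\<integral>\<^sup>+i. emeasure lebesgue (ball (fst i) (snd i)) \<partial>count_space C)"
        by (rule nn_integral_cmult) auto
      also have "(\<integral>\<^sup>+i. emeasure lebesgue (ball (fst i) (snd i)) \<partial>count_space C) = emeasure lebesgue ?W"
        by (rule nn_integral_disjoint_Union_sets[OF C(1) _ C(3)]) auto
      also have "emeasure lebesgue ?W \<le> emeasure lebesgue U"
      proof (rule emeasure_mono)
        show "?W \<subseteq> U"
        proof (rule UN_least)
          fix i assume "i \<in> C"
          with C(2) have "i \<in> K" by blast
          then show "ball (fst i) (snd i) \<subseteq> U" by (simp add: K_def case_prod_beta)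
        qed
      qed (use U(1) in auto)
      also have "U = N a b k \<union> (U - N a b k)" using U(2) by auto
      also have "emeasure lebesgue (N a b k \<union> (U - N a b k)) \<le> emeasure lebesgue (N a b k) + emeasure lebesgue (U - N a b k)"
        using Nm U(1) by (intro emeasure_subadditive) auto
      also have "\<dots> \<le> emeasure lebesgue (N a b k) + ennreal e"
        using U(3) by (intro add_left_mono) auto
      finally show ?thesis using ab e
        by (simp add: distrib_left ennreal_mult mult_left_mono)
    qed
    obtain m where m: "emeasure lebesgue (N a b k) = ennreal m" "0 \<le> m"
      using fin by (cases "emeasure lebesgue (N a b k)") auto
    have "b * m \<le> a * m + e" if e: "e > 0" for e
    proof -
      have "e / (a + 1) > 0" using ab e by simp
      from key[OF this] have "b * m \<le> a * m + a * (e / (a + 1))"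
        using m ab e by (simp add: ennreal_mult[symmetric] ennreal_plus[symmetric] del: ennreal_plus)
      also have "a * (e / (a + 1)) \<le> e" using ab e by (simp add: field_simps)
      finally show ?thesis by simp
    qed
    then have "b * m \<le> a * m" by (rule field_le_epsilon)
    then have "m = 0" using ab m(2) by (simp add: mult_le_cancel_right)
    then show ?thesis using m Nm by (intro null_setsI) auto
  qed
  have "(\<Union>k. \<Union>a\<in>{a\<in>\<rat>. 0 \<le> a}. \<Union>b\<in>{b\<in>\<rat>. a < b}. N a b k) \<in> null_sets lebesgue"
    using N0 countable_rat by (intro null_sets_UN null_sets_UN') (auto intro: countable_subset)
  then show ?thesis
  proof (rule AE_I')
    show "{x \<in> space lebesgue. \<not> f x \<le> HL f x} \<subseteq> (\<Union>k. \<Union>a\<in>{a\<in>\<rat>. 0 \<le> a}. \<Union>b\<in>{b\<in>\<rat>. a < b}. N a b k)"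
    proof
      fix x assume "x \<in> {x \<in> space lebesgue. \<not> f x \<le> HL f x}"
      then have x: "HL f x < f x" by auto
      obtain c where c: "HL f x < c" "c < f x" using dense[OF x] by auto
      obtain h where h: "HL f x = ennreal h" "0 \<le> h" using x by (cases "HL f x") auto
      obtain c' where c': "c = ennreal c'" "0 \<le> c'" using c(2) by (cases c) auto
      have "h < c'" using c(1) h c' by (simp add: ennreal_less_iff)
      then obtain a where a: "a \<in> \<rat>" "h < a" "a < c'" using Rats_dense_in_real by blast
      then obtain b where b: "b \<in> \<rat>" "a < b" "b < c'" using Rats_dense_in_real by blast
      obtain k :: nat where "norm x < real k" using reals_Archimedean2 by blast
      moreover have "HL f x \<le> ennreal a" using h a by (simp add: ennreal_leI)
      moreover have "ennreal b < f x" using c(2) c' b by (meson ennreal_leI less_imp_le le_less_trans)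
      ultimately have "x \<in> N a b k" by (simp add: N_def)
      then show "x \<in> (\<Union>k. \<Union>a\<in>{a\<in>\<rat>. 0 \<le> a}. \<Union>b\<in>{b\<in>\<rat>. a < b}. N a b k)"
        using a b h by fastforce
    qed
  qed
qed


section \<open>A reverse weak-type inequality\<close>

text \<open>
  At almost every point of the ball where \<open>f > l\<close>, small balls have average above \<open>l\<close>, whereas balls of radius at
  least \<open>R\<close> do not, by the assumption on the average. Increasing the radius by factors of \<open>5\<close> yields a
  radius \<open>r\<close> at which the average is still above \<open>l\<close> but the average at radius \<open>5 * r\<close> is not. A Vitali
  subfamily is disjoint while its fivefold enlargements cover; the enlargements carry at most \<open>5 ^ DIM('a) * l\<close>
  times the volume of the original balls, and on the original balls \<open>HL f\<close> is at least \<open>l / 2 ^ DIM('a)\<close>.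
\<close>

lemma reverse_weak_type:
  fixes f :: "'a::euclidean_space \<Rightarrow> ennreal"
  assumes f: "f \<in> borel_measurable lebesgue" and R: "0 < R" and l: "0 < l" "l < top"
    and avg: "(\<integral>\<^sup>+x\<in>ball z R. f x \<partial>lebesgue) \<le> l * emeasure lebesgue (ball z R)"
  shows "(\<integral>\<^sup>+x\<in>ball z R \<inter> {x. l < f x}. f x \<partial>lebesgue) \<le>
    ennreal (5 ^ DIM('a)) * l *
      emeasure lebesgue {y\<in>ball z (2 * R). l \<le> ennreal (2 ^ DIM('a)) * HL f y}"
proof -
  note f [measurable]
  \<comment> \<open>Truncation makes the hypothesis on one average control all averages of radius at least \<open>R\<close>.\<close>
  define g where "g x = f x * indicator (ball z R) x" for x
  have gm: "g \<in> borel_measurable lebesgue" unfolding g_def by measurable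
  define S where "S = {x\<in>ball z R. l < g x \<and> l < HL g x}"
  have av: "(\<integral>\<^sup>+y\<in>ball x r. g y \<partial>lebesgue) \<le> l * emeasure lebesgue (ball x r)" if r: "R \<le> r" for x r
  proof -
    have "(\<integral>\<^sup>+y\<in>ball x r. g y \<partial>lebesgue) \<le> (\<integral>\<^sup>+y\<in>ball z R. f y \<partial>lebesgue)"
      by (rule nn_integral_mono) (auto simp: g_def indicator_def)
    also note avg
    also have "l * emeasure lebesgue (ball z R) \<le> l * emeasure lebesgue (ball x r)"
      using r R by (intro mult_left_mono) (auto simp: emeasure_lebesgue_ball intro!: ennreal_leI mult_left_mono power_mono)
    finally show ?thesis .
  qed
  \<comment> \<open>The stopping radius: the last of \<open>t, 5 * t, 25 * t, ...\<close> with average above \<open>l\<close>.\<close>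
  have stop: "\<exists>r. 0 < r \<and> r \<le> R \<and>
      l * emeasure lebesgue (ball x r) < (\<integral>\<^sup>+y\<in>ball x r. g y \<partial>lebesgue) \<and>
      (\<integral>\<^sup>+y\<in>ball x (5 * r). g y \<partial>lebesgue) \<le> l * emeasure lebesgue (ball x (5 * r))"
    if x: "x \<in> S" for x
  proof -
    let ?P = "\<lambda>r. (\<integral>\<^sup>+y\<in>ball x r. g y \<partial>lebesgue) \<le> l * emeasure lebesgue (ball x r)"
    obtain t where t: "0 < t" "\<not> ?P t" using x by (auto simp: S_def less_HL_iff not_le)
    obtain m :: nat where "R / t < 5 ^ m" using real_arch_pow[of 5 "R / t"] by auto
    then have "?P (5 ^ m * t)" using t(1) by (intro av) (simp add: field_simps)
    moreover define k where "k = (LEAST m. ?P (5 ^ m * t))"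
    ultimately have k: "?P (5 ^ k * t)" by (metis (mono_tags, lifting) LeastI)
    have "k \<noteq> 0" using k t(2) by (intro notI) simp
    then obtain j where j: "k = Suc j" by (cases k) auto
    have nj: "\<not> ?P (5 ^ j * t)" using not_less_Least[of j "\<lambda>m. ?P (5 ^ m * t)"] j k_def by simp
    then have "\<not> R \<le> 5 ^ j * t" using av by blast
    then show ?thesis using t(1) nj k unfolding j
      by (intro exI[of _ "5 ^ j * t"]) (auto simp: not_le mult.assoc)
  qed
  define Q where "Q x r \<longleftrightarrow> 0 < r \<and> r \<le> R \<and>
      l * emeasure lebesgue (ball x r) < (\<integral>\<^sup>+y\<in>ball x r. g y \<partial>lebesgue) \<and>
      (\<integral>\<^sup>+y\<in>ball x (5 * r). g y \<partial>lebesgue) \<le> l * emeasure lebesgue (ball x (5 * r))" for x r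
  have "\<forall>x\<in>S. \<exists>r. Q x r" unfolding Q_def using stop by simp
  then obtain r where rQ: "\<forall>x\<in>S. Q x (r x)" by (rule bchoice[THEN exE])
  have r: "\<And>x. x \<in> S \<Longrightarrow> 0 < r x \<and> r x \<le> R"
      "\<And>x. x \<in> S \<Longrightarrow> l * emeasure lebesgue (ball x (r x)) < (\<integral>\<^sup>+y\<in>ball x (r x). g y \<partial>lebesgue)"
      "\<And>x. x \<in> S \<Longrightarrow> (\<integral>\<^sup>+y\<in>ball x (5 * r x). g y \<partial>lebesgue) \<le> l * emeasure lebesgue (ball x (5 * r x))"
    using rQ by (simp_all add: Q_def)
  have sub: "S \<subseteq> (\<Union>x\<in>S. ball x (r x))" using r(1) by force
  obtain C where C: "countable C" "C \<subseteq> S"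
     "pairwise (\<lambda>i j. disjnt (ball i (r i)) (ball j (r j))) C"
     "S \<subseteq> (\<Union>i\<in>C. ball i (5 * r i))"
    by (rule Vitali_covering_lemma_balls[OF sub r(1)])
  have pt: "AE x in lebesgue. f x * indicator (ball z R \<inter> {x. l < f x}) x \<le> g x * indicator S x"
    using AE_le_HL[OF gm]
  proof eventually_elim
    fix x assume h: "g x \<le> HL g x"
    show "f x * indicator (ball z R \<inter> {x. l < f x}) x \<le> g x * indicator S x"
      using h by (auto simp: S_def g_def indicator_def split: if_splits)
  qed
  have "(\<integral>\<^sup>+x\<in>ball z R \<inter> {x. l < f x}. f x \<partial>lebesgue) \<le> (\<integral>\<^sup>+x\<in>S. g x \<partial>lebesgue)"
    using pt by (rule nn_integral_mono_AE)
  also have "\<dots> \<le> (\<integral>\<^sup>+i. (\<integral>\<^sup>+x\<in>ball i (5 * r i). g x \<partial>lebesgue) \<partial>count_space C)"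
    by (rule set_nn_integral_Union_le[OF C(1) _ gm C(4)]) auto
  also have "\<dots> \<le> (\<integral>\<^sup>+i. ennreal (5 ^ DIM('a)) * l * emeasure lebesgue (ball i (r i)) \<partial>count_space C)"
  proof (rule nn_integral_mono)
    fix i assume "i \<in> space (count_space C)"
    then have i: "i \<in> S" using C(2) by auto
    have "(\<integral>\<^sup>+x\<in>ball i (5 * r i). g x \<partial>lebesgue) \<le> l * emeasure lebesgue (ball i (5 * r i))" by (rule r(3)[OF i])
    also have "emeasure lebesgue (ball i (5 * r i)) = ennreal (5 ^ DIM('a)) * emeasure lebesgue (ball i (r i))"
      using r(1)[OF i] by (intro emeasure_lebesgue_ball_scale) auto
    finally show "(\<integral>\<^sup>+x\<in>ball i (5 * r i). g x \<partial>lebesgue) \<le> ennreal (5 ^ DIM('a)) * l * emeasure lebesgue (ball i (r i))"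
      by (simp add: mult_ac)
  qed
  also have "\<dots> = ennreal (5 ^ DIM('a)) * l * (\<integral>\<^sup>+i. emeasure lebesgue (ball i (r i)) \<partial>count_space C)"
    by (rule nn_integral_cmult) auto
  also have "(\<integral>\<^sup>+i. emeasure lebesgue (ball i (r i)) \<partial>count_space C) = emeasure lebesgue (\<Union>i\<in>C. ball i (r i))"
    by (rule nn_integral_disjoint_Union_sets[OF C(1) _ C(3)]) auto
  also have "emeasure lebesgue (\<Union>i\<in>C. ball i (r i)) \<le>
      emeasure lebesgue {y\<in>ball z (2 * R). l \<le> ennreal (2 ^ DIM('a)) * HL f y}"
  proof (rule emeasure_mono)
    have [measurable]: "HL f \<in> borel_measurable lebesgue" by (rule borel_measurable_HL[OF f])
    have "{y\<in>ball z (2 * R). l \<le> ennreal (2 ^ DIM('a)) * HL f y} =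
      {y\<in>space lebesgue. l \<le> ennreal (2 ^ DIM('a)) * HL f y} \<inter> ball z (2 * R)" by auto
    also have "\<dots> \<in> sets lebesgue" by measurable
    finally show "{y\<in>ball z (2 * R). l \<le> ennreal (2 ^ DIM('a)) * HL f y} \<in> sets lebesgue" .
    show "(\<Union>i\<in>C. ball i (r i)) \<subseteq> {y\<in>ball z (2 * R). l \<le> ennreal (2 ^ DIM('a)) * HL f y}"
    proof safe
      fix i y assume iC: "i \<in> C" and y: "y \<in> ball i (r i)"
      then have i: "i \<in> S" using C(2) by auto
      have "dist z i < R" using i by (auto simp: S_def)
      then show "y \<in> ball z (2 * R)" using y r(1)[OF i] dist_triangle[of z y i] by auto
      \<comment> \<open>The centred ball of twice the radius contains the selected ball: this costs \<open>2 ^ DIM('a)\<close>.\<close>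
      have sub: "ball i (r i) \<subseteq> ball y (2 * r i)"
        using y r(1)[OF i] by (intro ball_subset_ball_iff[THEN iffD2]) (auto simp: dist_commute)
      have "l * emeasure lebesgue (ball i (r i)) \<le> (\<integral>\<^sup>+x\<in>ball i (r i). g x \<partial>lebesgue)"
        using r(2)[OF i] by simp
      also have "\<dots> \<le> (\<integral>\<^sup>+x\<in>ball y (2 * r i). f x \<partial>lebesgue)"
        using sub by (intro nn_integral_mono) (auto simp: g_def indicator_def)
      also have "\<dots> \<le> HL f y * emeasure lebesgue (ball y (2 * r i))"
        using r(1)[OF i] by (intro set_nn_integral_ball_le_HL) auto
      also have "emeasure lebesgue (ball y (2 * r i)) = ennreal (2 ^ DIM('a)) * emeasure lebesgue (ball i (r i))"
        using r(1)[OF i] by (intro emeasure_lebesgue_ball_scale) auto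
      finally have "l * emeasure lebesgue (ball i (r i)) \<le> (ennreal (2 ^ DIM('a)) * HL f y) * emeasure lebesgue (ball i (r i))"
        by (simp add: mult_ac)
      then show "l \<le> ennreal (2 ^ DIM('a)) * HL f y"
        using ennreal_divide_le_iff[OF emeasure_lebesgue_ball_pos emeasure_lebesgue_ball_finite,
            of "r i" "l * emeasure lebesgue (ball i (r i))" i] r(1)[OF i]
          emeasure_lebesgue_ball_pos[of "r i" i] emeasure_lebesgue_ball_finite[of i "r i"]
        by (simp add: mult_divide_eq_ennreal)
    qed
  qed
  finally show ?thesis by (simp add: mult_left_mono)
qed


section \<open>Logarithmic gain from iterating the maximal function\<close>

lemma borel_measurable_HL_iterate:
  fixes f :: "'a::euclidean_space \<Rightarrow> ennreal"
  assumes "f \<in> borel_measurable lebesgue"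
  shows "(HL ^^ j) f \<in> borel_measurable lebesgue"
  by (induction j) (simp_all add: assms borel_measurable_HL)

lemma HL_iterate_mono:
  assumes "\<And>y. f y \<le> g y"
  shows "(HL ^^ j) f x \<le> (HL ^^ j) g x"
  by (induction j arbitrary: x) (simp_all add: assms HL_mono)

text \<open>
  The first iterate must be excluded on the left: \<open>f \<le> HL f\<close> holds only almost everywhere, but after one more
  application of \<open>HL\<close> null sets no longer matter.
\<close>

lemma HL_iterate_incseq:
  fixes f :: "'a::euclidean_space \<Rightarrow> ennreal"
  assumes "f \<in> borel_measurable lebesgue" "1 \<le> i" "i \<le> j"
  shows "(HL ^^ i) f x \<le> (HL ^^ j) f x"
  using assms(3)
proof (induction rule: dec_induct)
  case (step k)
  from step.hyps assms(2) obtain k' where k: "k = Suc k'" by (cases k) auto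
  have "HL ((HL ^^ k') f) x \<le> HL (HL ((HL ^^ k') f)) x"
    by (rule HL_mono_AE[OF AE_le_HL[OF borel_measurable_HL_iterate[OF assms(1)]]])
  with step.IH k show ?case by simp
qed simp

text \<open>
  A discrete layer cake estimate. The levels below \<open>r ^ u\<close> are left out, and the bound accounts for that: it
  vanishes for \<open>v \<le> r ^ u\<close>, which is what restricts the integral of \<open>f\<close> to the set \<open>f > r ^ u\<close> in the next lemma.
\<close>

lemma dyadic_layer_sum_le:
  fixes r v :: real
  assumes "0 \<le> r" "r \<le> 1 / 2"
  shows "(\<Sum>l<u. r ^ l / 2 * of_bool (r ^ l \<le> v)) \<le> max 0 (v - r ^ u)"
proof (induction u)
  case (Suc u)
  have "r ^ u * r \<le> r ^ u * (1 / 2)" using assms by (intro mult_left_mono) auto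
  then have d: "r ^ Suc u \<le> r ^ u / 2" by (simp add: mult.commute)
  have "0 \<le> r ^ Suc u" using assms by simp
  then show ?case using Suc d by (cases "r ^ u \<le> v") auto
qed simp

lemma sets_lebesgue_ball_superlevel:
  fixes f :: "'a::euclidean_space \<Rightarrow> ennreal"
  assumes [measurable]: "f \<in> borel_measurable lebesgue"
  shows "{y\<in>ball z \<rho>. c \<le> f y} \<in> sets lebesgue"
proof -
  have "{y\<in>ball z \<rho>. c \<le> f y} = {y\<in>space lebesgue. c \<le> f y} \<inter> ball z \<rho>" by auto
  also have "\<dots> \<in> sets lebesgue" by measurable
  finally show ?thesis .
qed

lemma emeasure_ball_superlevel_eq_measure:
  fixes f :: "'a::euclidean_space \<Rightarrow> ennreal"
  assumes "f \<in> borel_measurable lebesgue"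
  shows "emeasure lebesgue {y\<in>ball z \<rho>. c \<le> f y} = ennreal (measure lebesgue {y\<in>ball z \<rho>. c \<le> f y})"
proof (rule emeasure_eq_ennreal_measure)
  have "emeasure lebesgue {y\<in>ball z \<rho>. c \<le> f y} \<le> emeasure lebesgue (ball z \<rho>)"
    by (intro emeasure_mono) auto
  also note emeasure_lebesgue_ball_finite
  finally show "emeasure lebesgue {y\<in>ball z \<rho>. c \<le> f y} \<noteq> top" by simp
qed

text \<open>
  The reverse weak-type inequality at level \<open>(1/q) ^ u\<close>, with the integral on its left bounded below by layers
  at the levels \<open>(1/q) ^ l\<close>. Since \<open>HL\<close> loses a factor \<open>q = 2 ^ DIM('a)\<close> in the level there, powers of \<open>1/q\<close> are
  the natural scale.
\<close>

lemma superlevel_measure_growth_step: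
  fixes f :: "'a::euclidean_space \<Rightarrow> ennreal"
  defines "q \<equiv> (2::real) ^ DIM('a)"
  assumes f: "f \<in> borel_measurable lebesgue" and \<rho>: "0 < \<rho>"
    and avg: "(\<integral>\<^sup>+x\<in>ball z \<rho>. f x \<partial>lebesgue) \<le> ennreal ((1/q) ^ u) * emeasure lebesgue (ball z \<rho>)"
  shows "(\<Sum>l<u. (1/q) ^ l / 2 * measure lebesgue {y\<in>ball z \<rho>. ennreal ((1/q) ^ l) \<le> f y}) \<le>
    5 ^ DIM('a) * (1/q) ^ u * measure lebesgue {y\<in>ball z (2 * \<rho>). ennreal ((1/q) ^ Suc u) \<le> HL f y}"
proof -
  note f [measurable]
  have q: "0 < q" "2 \<le> q"
    unfolding q_def using self_le_power[of "2::real" "DIM('a)"] by simp_all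
  then have r: "0 < 1/q" "1/q \<le> 1/2" by auto
  let ?S = "\<lambda>l. {y\<in>ball z \<rho>. ennreal ((1/q) ^ l) \<le> f y}"
  let ?T = "{y\<in>ball z (2 * \<rho>). ennreal ((1/q) ^ Suc u) \<le> HL f y}"
  let ?c = "ennreal ((1/q) ^ u)"
  have Sm [measurable]: "?S l \<in> sets lebesgue" for l by (rule sets_lebesgue_ball_superlevel[OF f])
  have term_eq: "ennreal ((1/q) ^ l / 2 * measure lebesgue (?S l)) =
      ennreal ((1/q) ^ l / 2) * emeasure lebesgue (?S l)" for l
    unfolding emeasure_ball_superlevel_eq_measure[OF f] using q by (intro ennreal_mult) auto
  have sup: "emeasure lebesgue {y\<in>ball z (2 * \<rho>). ?c \<le> ennreal (2 ^ DIM('a)) * HL f y} \<le> emeasure lebesgue ?T"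
  proof (rule emeasure_mono[OF _ sets_lebesgue_ball_superlevel[OF borel_measurable_HL[OF f]]])
    show "{y\<in>ball z (2 * \<rho>). ?c \<le> ennreal (2 ^ DIM('a)) * HL f y} \<subseteq> ?T"
    proof safe
      fix y assume "?c \<le> ennreal (2 ^ DIM('a)) * HL f y"
      then have "ennreal (1/q) * ?c \<le> ennreal (1/q) * (ennreal q * HL f y)"
        by (intro mult_left_mono) (simp_all add: q_def)
      also have "\<dots> = HL f y" using q
        by (simp add: mult.assoc[symmetric] ennreal_mult[symmetric])
      finally show "ennreal ((1/q) ^ Suc u) \<le> HL f y" using q by (simp add: ennreal_mult[symmetric])
    qed
  qed
  have "ennreal (\<Sum>l<u. (1/q) ^ l / 2 * measure lebesgue (?S l)) =
      (\<Sum>l<u. ennreal ((1/q) ^ l / 2 * measure lebesgue (?S l)))"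
    using q by (intro sum_ennreal[symmetric]) auto
  also have "\<dots> = (\<Sum>l<u. ennreal ((1/q) ^ l / 2) * emeasure lebesgue (?S l))"
    by (rule sum.cong[OF refl term_eq])
  also have "\<dots> = (\<integral>\<^sup>+y. (\<Sum>l<u. ennreal ((1/q) ^ l / 2) * indicator (?S l) y) \<partial>lebesgue)"
  proof (subst nn_integral_sum)
    show "(\<Sum>l<u. ennreal ((1/q) ^ l / 2) * emeasure lebesgue (?S l)) =
        (\<Sum>l<u. \<integral>\<^sup>+y. ennreal ((1/q) ^ l / 2) * indicator (?S l) y \<partial>lebesgue)"
      by (rule sum.cong[OF refl], rule nn_integral_cmult_indicator[symmetric], rule Sm)
  qed measurable
  also have "\<dots> \<le> (\<integral>\<^sup>+y\<in>ball z \<rho> \<inter> {y. ?c < f y}. f y \<partial>lebesgue)"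
  proof (rule nn_integral_mono)
    fix y
    show "(\<Sum>l<u. ennreal ((1/q) ^ l / 2) * indicator (?S l) y) \<le> f y * indicator (ball z \<rho> \<inter> {y. ?c < f y}) y"
    proof (cases "y \<in> ball z \<rho>")
      case True
      show ?thesis
      proof (cases "f y")
        case top
        then show ?thesis using True by simp
      next
        case (real v)
        have layer_eq: "ennreal ((1/q) ^ l / 2) * indicator (?S l) y = ennreal ((1/q) ^ l / 2 * of_bool ((1/q) ^ l \<le> v))" for l
          using True real q by (auto simp: indicator_def)
        have "(\<Sum>l<u. ennreal ((1/q) ^ l / 2) * indicator (?S l) y) =
            (\<Sum>l<u. ennreal ((1/q) ^ l / 2 * of_bool ((1/q) ^ l \<le> v)))"
          by (rule sum.cong[OF refl layer_eq])
        also have "\<dots> = ennreal (\<Sum>l<u. (1/q) ^ l / 2 * of_bool ((1/q) ^ l \<le> v))"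
          using q by (intro sum_ennreal) auto
        also have "\<dots> \<le> ennreal (max 0 (v - (1/q) ^ u))"
          using r by (intro ennreal_leI dyadic_layer_sum_le) auto
        also have "\<dots> \<le> f y * indicator (ball z \<rho> \<inter> {y. ?c < f y}) y"
          using True real q by (auto simp: indicator_def max_def ennreal_less_iff not_less intro!: ennreal_leI)
        finally show ?thesis .
      qed
    qed simp
  qed
  also have "\<dots> \<le> ennreal (5 ^ DIM('a)) * ?c *
      emeasure lebesgue {y\<in>ball z (2 * \<rho>). ?c \<le> ennreal (2 ^ DIM('a)) * HL f y}"
    using \<rho> q avg by (intro reverse_weak_type[OF f]) auto
  also have "\<dots> \<le> ennreal (5 ^ DIM('a)) * ?c * emeasure lebesgue ?T"
    by (rule mult_left_mono[OF sup]) simp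
  also have "\<dots> = ennreal (5 ^ DIM('a) * (1/q) ^ u * measure lebesgue ?T)"
    unfolding emeasure_ball_superlevel_eq_measure[OF borel_measurable_HL[OF f]]
    by (subst ennreal_mult', use q in simp)+ (rule refl)
  finally show ?thesis 
    by (rule ennreal_le_iff[THEN iffD1, rotated])
       (intro mult_nonneg_nonneg zero_le_power measure_nonneg, use q in simp_all)
qed

text \<open>
  Normalised as \<open>(1/q) ^ u\<close> times measure, the superlevel sets of one iterate dominate a partial sum of
  those of the previous iterate. Starting from a constant, \<open>j\<close> partial sums produce the binomial
  coefficient, a polynomial of degree \<open>j\<close> in \<open>u\<close>, that is, in the logarithm of the level. The assumption on the
  value at \<open>z\<close> keeps the averages over the growing balls below the levels in use; \<open>j < m\<close> is needed because
  an average of one iterate is controlled by the next one.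
\<close>

lemma superlevel_measure_HL_iterate_ge:
  fixes A :: "'a::euclidean_space set"
  defines "q \<equiv> (2::real) ^ DIM('a)"
  defines "\<kappa> \<equiv> 1 / (2 * 5 ^ DIM('a) * q)"
  assumes A: "A \<in> sets lebesgue" "A \<subseteq> ball z R" and R: "0 < R"
    and u: "1 \<le> u" "(HL ^^ m) (indicator A) z \<le> ennreal ((1/q) ^ u)" and j: "j < m"
  shows "\<kappa> ^ Suc j * q ^ Suc u * real (u - Suc j choose j) * measure lebesgue A \<le>
    measure lebesgue {y\<in>ball z (2 ^ Suc j * R). ennreal ((1/q) ^ Suc u) \<le> (HL ^^ Suc j) (indicator A) y}"
  using u j
proof (induction j arbitrary: u)
  case (0 u)
  have q: "0 < q" "2 \<le> q"
    unfolding q_def using self_le_power[of "2::real" "DIM('a)"] by simp_all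
  define F where "F = measure lebesgue {y\<in>ball z (2 * R). ennreal ((1/q) ^ Suc u) \<le> HL (indicator A) y}"
  have im: "indicator A \<in> borel_measurable lebesgue" using A(1) by simp
  have "(HL ^^ 1) (indicator A) z \<le> (HL ^^ m) (indicator A) z"
    using 0 by (intro HL_iterate_incseq im) auto
  then have "HL (indicator A) z \<le> ennreal ((1/q) ^ u)" using 0 by auto
  then have avg: "(\<integral>\<^sup>+x\<in>ball z R. indicator A x \<partial>lebesgue) \<le> ennreal ((1/q) ^ u) * emeasure lebesgue (ball z R)"
    using R by (auto simp: HL_le_iff)
  have level0: "{y\<in>ball z R. 1 \<le> (indicator A y :: ennreal)} = A"
    using A(2) by (auto simp: indicator_def split: if_splits)
  define G where "G l = measure lebesgue {y\<in>ball z R. ennreal ((1/q) ^ l) \<le> indicator A y}" for l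
  have G_nonneg: "0 \<le> G l" for l unfolding G_def by (rule measure_nonneg)
  have "measure lebesgue A / 2 = (1/q) ^ 0 / 2 * G 0"
    using level0 by (simp add: G_def)
  also have "\<dots> \<le> (\<Sum>l<u. (1/q) ^ l / 2 * G l)"
    by (rule member_le_sum) (use 0(1) q G_nonneg in auto)
  also have "\<dots> \<le> 5 ^ DIM('a) * (1/q) ^ u * F"
    using superlevel_measure_growth_step[OF im R avg[unfolded q_def]] unfolding q_def F_def G_def .
  finally have *: "measure lebesgue A / 2 \<le> 5 ^ DIM('a) * (1/q) ^ u * F" .
  have "measure lebesgue A * q ^ u / (2 * 5 ^ DIM('a)) = q ^ u / 5 ^ DIM('a) * (measure lebesgue A / 2)"
    by (simp add: field_simps)
  also have "\<dots> \<le> q ^ u / 5 ^ DIM('a) * (5 ^ DIM('a) * (1/q) ^ u * F)"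
    using q by (intro mult_left_mono *) auto
  also have "\<dots> = F" using q by (simp add: power_divide)
  finally have "measure lebesgue A * q ^ u / (2 * 5 ^ DIM('a)) \<le> F" .
  moreover have "\<kappa> ^ Suc 0 * q ^ Suc u * real (u - Suc 0 choose 0) * measure lebesgue A
      = measure lebesgue A * q ^ u / (2 * 5 ^ DIM('a))"
    using q by (simp add: \<kappa>_def)
  ultimately show ?case by (simp add: F_def)
next
  case (Suc j u)
  have q: "0 < q" "2 \<le> q"
    unfolding q_def using self_le_power[of "2::real" "DIM('a)"] by simp_all
  have \<kappa>: "0 < \<kappa>" using q by (simp add: \<kappa>_def)
  let ?f = "(HL ^^ Suc j) (indicator A)"
  let ?\<rho> = "2 ^ Suc j * R"
  have \<rho>_pos: "0 < ?\<rho>" using R by simp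
  define G where "G l = measure lebesgue {y\<in>ball z ?\<rho>. ennreal ((1/q) ^ l) \<le> ?f y}" for l
  have G_nonneg: "0 \<le> G l" for l unfolding G_def by (rule measure_nonneg)
  define F where "F = measure lebesgue {y\<in>ball z (2 * ?\<rho>). ennreal ((1/q) ^ Suc u) \<le> HL ?f y}"
  have im: "indicator A \<in> borel_measurable lebesgue" using A(1) by simp
  have "(HL ^^ Suc (Suc j)) (indicator A) z \<le> (HL ^^ m) (indicator A) z"
    using Suc.prems by (intro HL_iterate_incseq im) auto
  then have "HL ?f z \<le> ennreal ((1/q) ^ u)" using Suc.prems by auto
  then have avg: "(\<integral>\<^sup>+x\<in>ball z ?\<rho>. ?f x \<partial>lebesgue) \<le> ennreal ((1/q) ^ u) * emeasure lebesgue (ball z ?\<rho>)"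
    using R by (auto simp: HL_le_iff)
  have G_ge: "\<kappa> ^ Suc j * q ^ Suc l * real (l - Suc j choose j) * measure lebesgue A \<le> G (Suc l)"
    if l: "1 \<le> l" "l < u" for l
    unfolding G_def
  proof (rule Suc.IH)
    have "(1/q) ^ u \<le> (1/q) ^ l" using q l by (intro power_decreasing) auto
    then show "(HL ^^ m) (indicator A) z \<le> ennreal ((1/q) ^ l)"
      using Suc.prems(2) by (meson ennreal_leI order_trans)
  qed (use l Suc.prems in auto)
  have regroup: "a / 2 * (c * b * d * e) = c / 2 * d * e" if "a * b = 1" for a b c d e :: real
  proof -
    have "a / 2 * (c * b * d * e) = (a * b) * (c / 2 * d * e)" by simp
    then show ?thesis using that by simp
  qed
  \<comment> \<open>The hockey-stick identity turns the partial sum into the next binomial coefficient.\<close>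
  have "real (u - Suc (Suc j) choose Suc j) = (\<Sum>k<u - Suc (Suc j). real (k choose j))"
  proof (cases "u - Suc (Suc j)")
    case (Suc n)
    then show ?thesis by (simp add: lessThan_Suc_atMost sum_choose_upper[symmetric] del: sum.lessThan_Suc binomial_Suc_Suc)
  qed simp
  then have "\<kappa> ^ Suc j / 2 * real (u - Suc (Suc j) choose Suc j) * measure lebesgue A
      = (\<Sum>k<u - Suc (Suc j). \<kappa> ^ Suc j / 2 * real (k choose j) * measure lebesgue A)"
    by (simp add: sum_distrib_left sum_distrib_right)
  also have "\<dots> \<le> (\<Sum>k<u - Suc (Suc j). (1/q) ^ (k + Suc (Suc j)) / 2 * G (k + Suc (Suc j)))"
  proof (rule sum_mono)
    fix k assume k: "k \<in> {..<u - Suc (Suc j)}"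
    have inv: "(1/q) ^ (k + Suc (Suc j)) * q ^ Suc (k + Suc j) = 1"
      using q by (simp add: power_divide)
    have "\<kappa> ^ Suc j / 2 * real (k choose j) * measure lebesgue A =
        (1/q) ^ (k + Suc (Suc j)) / 2 * (\<kappa> ^ Suc j * q ^ Suc (k + Suc j) * real (k choose j) * measure lebesgue A)"
      by (rule regroup[OF inv, symmetric])
    also have "\<dots> \<le> (1/q) ^ (k + Suc (Suc j)) / 2 * G (Suc (k + Suc j))"
      using k q G_ge[of "k + Suc j", unfolded add_diff_cancel_right'] by (intro mult_left_mono) auto
    finally show "\<kappa> ^ Suc j / 2 * real (k choose j) * measure lebesgue A \<le>
        (1/q) ^ (k + Suc (Suc j)) / 2 * G (k + Suc (Suc j))" by (simp only: add_Suc_right)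
  qed
  also have "\<dots> = (\<Sum>l\<in>(\<lambda>k. k + Suc (Suc j)) ` {..<u - Suc (Suc j)}. (1/q) ^ l / 2 * G l)"
    by (subst sum.reindex) (auto simp: inj_on_def)
  also have "\<dots> \<le> (\<Sum>l<u. (1/q) ^ l / 2 * G l)"
    by (rule sum_mono2) (use q G_nonneg in auto)
  also have "\<dots> \<le> 5 ^ DIM('a) * (1/q) ^ u * F"
    using superlevel_measure_growth_step[OF borel_measurable_HL_iterate[OF im] \<rho>_pos avg[unfolded q_def]]
    unfolding q_def F_def G_def .
  finally have *: "\<kappa> ^ Suc j / 2 * real (u - Suc (Suc j) choose Suc j) * measure lebesgue A \<le>
    5 ^ DIM('a) * (1/q) ^ u * F" .
  have "\<kappa> ^ Suc (Suc j) * q ^ Suc u * real (u - Suc (Suc j) choose Suc j) * measure lebesgue A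
     = (q ^ u / 5 ^ DIM('a)) * (\<kappa> ^ Suc j / 2 * real (u - Suc (Suc j) choose Suc j) * measure lebesgue A)"
    using q by (simp add: \<kappa>_def field_simps)
  also have "\<dots> \<le> (q ^ u / 5 ^ DIM('a)) * (5 ^ DIM('a) * (1/q) ^ u * F)"
    using q by (intro mult_left_mono *) auto
  also have "\<dots> = F" using q by (simp add: field_simps)
  finally show ?case by (simp add: F_def mult.assoc[symmetric])
qed

text \<open>
  Integrating the previous estimate over one level turns it into a lower bound for one more average at the
  point \<open>x\<close> itself. If the iterate is above \<open>(1/q) ^ u\<close> at \<open>x\<close>, the levels cannot be used, but then that value is the
  lower bound.
\<close>

lemma HL_iterate_ge_log_gain:
  fixes E :: "'a::euclidean_space set" and x :: 'a
  defines "q \<equiv> (2::real) ^ DIM('a)"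
  defines "\<kappa> \<equiv> 1 / (2 * 5 ^ DIM('a) * q ^ 2)"
  assumes E: "E \<in> sets lebesgue" and t: "0 < t" "ennreal t < HL (indicator E) x" and u: "1 \<le> u"
  shows "ennreal (min ((1/q) ^ u) (\<kappa> ^ Suc j * real (u - Suc j choose j) * t)) \<le> (HL ^^ (j + 2)) (indicator E) x"
proof -
  have q: "0 < q" "2 \<le> q"
    unfolding q_def using self_le_power[of "2::real" "DIM('a)"] by simp_all
  define k where "k = 1 / (2 * 5 ^ DIM('a) * q)"
  have k: "0 < k" "\<kappa> = k / q" using q by (auto simp: k_def \<kappa>_def power2_eq_square)
  obtain R where R: "0 < R" "ennreal t * emeasure lebesgue (ball x R) < (\<integral>\<^sup>+y\<in>ball x R. indicator E y \<partial>lebesgue)"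
    using t(2) by (auto simp: less_HL_iff)
  \<comment> \<open>Only the part of \<open>E\<close> that makes the average at \<open>x\<close> large is used, so that it lies in a ball.\<close>
  define A where "A = E \<inter> ball x R"
  have A: "A \<in> sets lebesgue" "A \<subseteq> ball x R" using E by (auto simp: A_def)
  have im: "indicator A \<in> borel_measurable lebesgue" using A(1) by simp
  have "(\<integral>\<^sup>+y\<in>ball x R. indicator E y \<partial>lebesgue) = (\<integral>\<^sup>+y. indicator A y \<partial>lebesgue)"
    by (rule nn_integral_cong) (auto simp: A_def indicator_def)
  also have "\<dots> = emeasure lebesgue A" using A by simp
  finally have tA: "ennreal t * emeasure lebesgue (ball x R) < emeasure lebesgue A" using R by simp
  have finA: "emeasure lebesgue A = ennreal (measure lebesgue A)"
  proof (rule emeasure_eq_ennreal_measure)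
    have "emeasure lebesgue A \<le> emeasure lebesgue (ball x R)" using A by (intro emeasure_mono) auto
    also note emeasure_lebesgue_ball_finite
    finally show "emeasure lebesgue A \<noteq> top" by simp
  qed
  let ?a = "(HL ^^ (j + 2)) (indicator A) x"
  define b where "b = real (u - Suc j choose j)"
  have "ennreal (min ((1/q) ^ u) (\<kappa> ^ Suc j * b * t)) \<le> ?a"
  proof (cases "?a \<le> ennreal ((1/q) ^ u)")
    case False
    then have "ennreal ((1/q) ^ u) \<le> ?a" by simp
    moreover have "ennreal (min ((1/q) ^ u) (\<kappa> ^ Suc j * b * t)) \<le> ennreal ((1/q) ^ u)"
      by (intro ennreal_leI) simp
    ultimately show ?thesis by (rule order_trans[rotated])
  next
    case True
    define S where "S = {y\<in>ball x (2 ^ Suc j * R). ennreal ((1/q) ^ Suc u) \<le> (HL ^^ Suc j) (indicator A) y}"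
    have "k ^ Suc j * q ^ Suc u * b * measure lebesgue A \<le> measure lebesgue S"
      unfolding S_def b_def k_def q_def
      by (rule superlevel_measure_HL_iterate_ge[OF A R(1) u True[unfolded q_def]]) simp
    then have "(1/q) ^ Suc u * (k ^ Suc j * q ^ Suc u * b * measure lebesgue A) \<le> (1/q) ^ Suc u * measure lebesgue S"
      by (rule mult_left_mono) (use q in simp)
    moreover have "(1/q) ^ Suc u * (k ^ Suc j * q ^ Suc u * b * measure lebesgue A) = k ^ Suc j * b * measure lebesgue A"
      using q by (simp add: power_divide)
    ultimately have "ennreal (k ^ Suc j * b * measure lebesgue A) \<le> ennreal ((1/q) ^ Suc u * measure lebesgue S)"
      by (intro ennreal_leI) simp
    also have "\<dots> = ennreal ((1/q) ^ Suc u) * emeasure lebesgue S"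
      unfolding S_def emeasure_ball_superlevel_eq_measure[OF borel_measurable_HL_iterate[OF im]]
      by (rule ennreal_mult[OF _ measure_nonneg]) (use q in simp)
    also have "\<dots> = (\<integral>\<^sup>+y. ennreal ((1/q) ^ Suc u) * indicator S y \<partial>lebesgue)"
      by (rule nn_integral_cmult_indicator[symmetric])
         (unfold S_def, rule sets_lebesgue_ball_superlevel[OF borel_measurable_HL_iterate[OF im]])
    also have "\<dots> \<le> (\<integral>\<^sup>+y\<in>ball x (2 ^ Suc j * R). (HL ^^ Suc j) (indicator A) y \<partial>lebesgue)"
    proof (rule nn_integral_mono)
      fix y
      show "ennreal ((1/q) ^ Suc u) * indicator S y \<le> (HL ^^ Suc j) (indicator A) y * indicator (ball x (2 ^ Suc j * R)) y"
      proof (cases "y \<in> S")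
        case True
        then have "y \<in> ball x (2 ^ Suc j * R)" "ennreal ((1/q) ^ Suc u) \<le> (HL ^^ Suc j) (indicator A) y"
          unfolding S_def by blast+
        with True show ?thesis by (simp only: indicator_simps mult_1_right)
      qed (simp only: indicator_simps not_False_eq_True mult_zero_right zero_le)
    qed
    also have "\<dots> \<le> HL ((HL ^^ Suc j) (indicator A)) x * emeasure lebesgue (ball x (2 ^ Suc j * R))"
      using R by (intro set_nn_integral_ball_le_HL) auto
    also have "emeasure lebesgue (ball x (2 ^ Suc j * R)) = ennreal (q ^ Suc j) * emeasure lebesgue (ball x R)"
    proof -
      have "(2 ^ Suc j) ^ DIM('a) = q ^ Suc j"
        unfolding q_def power_mult[symmetric] by (simp only: mult.commute)
      then show ?thesis
        using emeasure_lebesgue_ball_scale[of R "2 ^ Suc j" x x] R(1) by simp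
    qed
    finally have *: "ennreal (k ^ Suc j * b * measure lebesgue A) \<le> ?a * (ennreal (q ^ Suc j) * emeasure lebesgue (ball x R))"
      by (simp only: funpow.simps o_apply add_2_eq_Suc')
    obtain V where V: "emeasure lebesgue (ball x R) = ennreal V" "0 < V"
      using emeasure_lebesgue_ball_pos[OF R(1), of x] emeasure_lebesgue_ball_finite[of x R]
      by (cases "emeasure lebesgue (ball x R)") auto
    obtain a where a: "?a = ennreal a" "0 \<le> a" using True by (cases ?a) (auto simp: top_unique)
    have tV: "t * V \<le> measure lebesgue A"
      using tA finA t V by (simp add: ennreal_mult[symmetric] ennreal_less_iff)
    have "k ^ Suc j * b * measure lebesgue A \<le> a * (q ^ Suc j * V)"
    proof -
      have "?a * (ennreal (q ^ Suc j) * emeasure lebesgue (ball x R)) = ennreal (a * (q ^ Suc j * V))"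
        unfolding a(1) V(1) using a(2) V(2) q by (simp add: ennreal_mult)
      with * show ?thesis using a(2) V(2) q by (simp add: ennreal_le_iff del: power_Suc)
    qed
    then have "k ^ Suc j * b * (t * V) \<le> a * (q ^ Suc j * V)"
      by (rule order_trans[rotated]) (use tV k in \<open>auto simp: b_def intro!: mult_left_mono\<close>)
    then have "(k ^ Suc j * b * t) * V \<le> (a * q ^ Suc j) * V" by (simp add: mult_ac)
    then have "k ^ Suc j * b * t \<le> a * q ^ Suc j" using V by simp
    then have "\<kappa> ^ Suc j * b * t \<le> a" using q unfolding k(2) power_divide by (simp add: field_simps)
    then have "ennreal (\<kappa> ^ Suc j * b * t) \<le> ?a" using a by (simp add: ennreal_leI)
    moreover have "ennreal (min ((1/q) ^ u) (\<kappa> ^ Suc j * b * t)) \<le> ennreal (\<kappa> ^ Suc j * b * t)"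
      by (intro ennreal_leI) simp
    ultimately show ?thesis by (rule order_trans[rotated])
  qed
  also have "?a \<le> (HL ^^ (j + 2)) (indicator E) x"
    by (rule HL_iterate_mono) (auto simp: A_def indicator_def)
  finally show ?thesis unfolding b_def .
qed


section \<open>Luxemburg norms of indicator functions\<close>

lemma modular_indicator_div:
  assumes "0 < l"
  shows "modular p (\<lambda>x. indicator S x / ereal l) = (\<integral>\<^sup>+x\<in>S. ennreal (l powr - p x) \<partial>lebesgue)"
  unfolding modular_def
proof (rule nn_integral_cong)
  fix x
  show "abs_powr (indicator S x / ereal l) (p x) = ennreal (l powr - p x) * indicator S x"
  proof (cases "x \<in> S")
    case True
    have "(1 / l) powr p x = l powr - p x"
      using assms by (simp add: powr_divide powr_minus field_simps)
    then show ?thesis using True assms by (simp add: abs_powr_def one_ereal_def)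
  next
    case False
    then show ?thesis by (simp add: abs_powr_def zero_ereal_def)
  qed
qed

lemma Lp_norm_indicator_le:
  assumes "0 < l" "(\<integral>\<^sup>+x\<in>S. ennreal (l powr - p x) \<partial>lebesgue) \<le> 1"
  shows "Lp_norm p (indicator S) \<le> ennreal l"
  unfolding Lp_norm_def
  by (rule Inf_lower) (use assms in \<open>auto simp: modular_indicator_div\<close>)

lemma Lp_norm_indicator_lessE:
  assumes "Lp_norm p (indicator S) < c"
  obtains l where "0 < l" "ennreal l < c" "(\<integral>\<^sup>+x\<in>S. ennreal (l powr - p x) \<partial>lebesgue) \<le> 1"
  using assms unfolding Lp_norm_def Inf_less_iff by (auto simp: modular_indicator_div)

text \<open>
  Exponents at least \<open>1\<close> make the modular decrease at least linearly in the scaling, so a modular bounded by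
  \<open>C\<close> instead of \<open>1\<close> costs only a factor \<open>C\<close> in the norm.
\<close>

lemma Lp_norm_indicator_le_mult:
  assumes p: "AE x in lebesgue. 1 \<le> p x" and l: "0 < l" and C: "1 \<le> C"
    and le: "(\<integral>\<^sup>+x\<in>S. ennreal (l powr - p x) \<partial>lebesgue) \<le> ennreal C"
    and m: "p \<in> borel_measurable lebesgue" "S \<in> sets lebesgue"
  shows "Lp_norm p (indicator S) \<le> ennreal (C * l)"
proof (rule Lp_norm_indicator_le)
  note m [measurable]
  have "(\<integral>\<^sup>+x\<in>S. ennreal ((C * l) powr - p x) \<partial>lebesgue)
      \<le> (\<integral>\<^sup>+x. ennreal (1 / C) * (ennreal (l powr - p x) * indicator S x) \<partial>lebesgue)"
  proof (rule nn_integral_mono_AE)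
    show "AE x in lebesgue. ennreal ((C * l) powr - p x) * indicator S x
        \<le> ennreal (1 / C) * (ennreal (l powr - p x) * indicator S x)"
      using p
    proof eventually_elim
      fix x assume "1 \<le> p x"
      then have "C powr - p x \<le> C powr - 1" using C by (intro powr_mono) auto
      also have "\<dots> = 1 / C" using C by (simp add: powr_minus_divide)
      finally have "(C * l) powr - p x \<le> 1 / C * l powr - p x"
        using C l mult_right_mono[of "C powr - p x" "1 / C" "l powr - p x"] by (simp add: powr_mult)
      then have "ennreal ((C * l) powr - p x) \<le> ennreal (1 / C) * ennreal (l powr - p x)"
        using C by (subst ennreal_mult[symmetric]) (auto intro: ennreal_leI)
      then show "ennreal ((C * l) powr - p x) * indicator S x
        \<le> ennreal (1 / C) * (ennreal (l powr - p x) * indicator S x)"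
        by (auto simp: indicator_def)
    qed
  qed
  also have "\<dots> = ennreal (1 / C) * (\<integral>\<^sup>+x\<in>S. ennreal (l powr - p x) \<partial>lebesgue)"
    by (rule nn_integral_cmult) measurable
  also have "\<dots> \<le> ennreal (1 / C) * ennreal C"
    by (rule mult_left_mono[OF le]) simp
  also have "\<dots> = 1" using C by (simp add: ennreal_mult[symmetric])
  finally show "(\<integral>\<^sup>+x\<in>S. ennreal ((C * l) powr - p x) \<partial>lebesgue) \<le> 1" .
qed (use l C in auto)

lemma Lp_norm_indicator_mono:
  assumes "S \<subseteq> T"
  shows "Lp_norm p (indicator S) \<le> Lp_norm p (indicator T)"
proof (rule dense_ge)
  fix c assume "Lp_norm p (indicator T) < c"
  then obtain l where l: "0 < l" "ennreal l < c" "(\<integral>\<^sup>+x\<in>T. ennreal (l powr - p x) \<partial>lebesgue) \<le> 1"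
    by (rule Lp_norm_indicator_lessE)
  have "(\<integral>\<^sup>+x\<in>S. ennreal (l powr - p x) \<partial>lebesgue) \<le> (\<integral>\<^sup>+x\<in>T. ennreal (l powr - p x) \<partial>lebesgue)"
    using assms by (intro nn_integral_mono) (auto simp: indicator_def)
  then have "Lp_norm p (indicator S) \<le> ennreal l"
    using l by (intro Lp_norm_indicator_le) auto
  then show "Lp_norm p (indicator S) \<le> c" using l(2) by simp
qed

lemma ennreal_le_divide_if_mult_le:
  assumes "0 < c" "0 \<le> w" "ennreal c * X \<le> ennreal w"
  shows "X \<le> ennreal (w / c)"
proof (cases X)
  case (real x)
  then have "c * x \<le> w" using assms by (simp add: ennreal_mult[symmetric])
  then show ?thesis using real assms by (simp add: field_simps ennreal_leI)
next
  case top
  then show ?thesis using assms by (simp add: ennreal_mult_top top_unique)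
qed

lemma ennreal_term_le_suminf:
  fixes f :: "nat \<Rightarrow> ennreal"
  shows "f j \<le> suminf f"
  using sum_le_suminf[of f "{j}"] by simp

text \<open>
  The countable triangle inequality. If \<open>l k\<close> is admissible for \<open>S k\<close> and \<open>L\<close> is the sum of all \<open>l k\<close>, then
  exponents at least \<open>1\<close> give \<open>L powr - p x \<le> l k / L * l k powr - p x\<close>; summing over \<open>k\<close> bounds the modular of the
  union by \<open>(\<Sum>k. l k / L) = 1\<close>.
\<close>

lemma Lp_norm_indicator_Union_le:
  fixes S :: "nat \<Rightarrow> (real^'n) set"
  assumes p: "AE x in lebesgue. 1 \<le> p x" and pm: "p \<in> borel_measurable lebesgue"
    and S: "\<And>k. S k \<in> sets lebesgue"
    and c: "\<And>k. Lp_norm p (indicator (S k)) \<le> ennreal (c k)" "\<And>k. 0 \<le> c k" "summable c"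
  shows "Lp_norm p (indicator (\<Union>k. S k)) \<le> ennreal (suminf c)"
proof (rule ennreal_le_epsilon)
  note pm [measurable] S [measurable]
  fix e :: real assume e: "0 < e"
  \<comment> \<open>The norm is an infimum, so admissible values exist only strictly above it; the slack sums to \<open>e\<close>.\<close>
  define d where "d k = c k + e * (1/2) ^ Suc k" for k
  have geo: "(\<lambda>k. e * (1/2) ^ Suc k) sums (e * 1)"
    by (intro sums_mult power_half_series)
  have dsum: "d sums (suminf c + e)"
    unfolding d_def using sums_add[OF summable_sums[OF c(3)] geo] by simp
  have "\<exists>l. 0 < l \<and> l \<le> d k \<and> (\<integral>\<^sup>+x\<in>S k. ennreal (l powr - p x) \<partial>lebesgue) \<le> 1" for k
  proof -
    have "Lp_norm p (indicator (S k)) < ennreal (d k)"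
      using c(1)[of k] by (rule le_less_trans) (use c(2)[of k] e in \<open>auto simp: d_def ennreal_less_iff\<close>)
    then obtain l where "0 < l" "ennreal l < ennreal (d k)" "(\<integral>\<^sup>+x\<in>S k. ennreal (l powr - p x) \<partial>lebesgue) \<le> 1"
      by (rule Lp_norm_indicator_lessE)
    then show ?thesis by (intro exI[of _ l]) (auto simp: ennreal_less_iff)
  qed
  then obtain l where l: "\<And>k. 0 < l k" "\<And>k. l k \<le> d k"
      "\<And>k. (\<integral>\<^sup>+x\<in>S k. ennreal (l k powr - p x) \<partial>lebesgue) \<le> 1"
    by metis
  have lsum: "summable l"
    by (rule summable_comparison_test'[OF sums_summable[OF dsum], of 0]) (use l in \<open>auto simp: less_imp_le\<close>)
  define L where "L = suminf l"
  have L: "0 < L" unfolding L_def by (rule suminf_pos[OF lsum l(1)])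
  have lL: "l k \<le> L" for k
    using sum_le_suminf[OF lsum, of "{k}"] l(1) by (simp add: L_def less_imp_le)
  have "(\<integral>\<^sup>+x\<in>(\<Union>k. S k). ennreal (L powr - p x) \<partial>lebesgue)
      \<le> (\<integral>\<^sup>+x. (\<Sum>k. ennreal (l k / L) * (ennreal (l k powr - p x) * indicator (S k) x)) \<partial>lebesgue)"
  proof (rule nn_integral_mono_AE)
    show "AE x in lebesgue. ennreal (L powr - p x) * indicator (\<Union>k. S k) x
        \<le> (\<Sum>k. ennreal (l k / L) * (ennreal (l k powr - p x) * indicator (S k) x))"
      using p
    proof eventually_elim
      fix x assume px: "1 \<le> p x"
      show "ennreal (L powr - p x) * indicator (\<Union>k. S k) x
        \<le> (\<Sum>k. ennreal (l k / L) * (ennreal (l k powr - p x) * indicator (S k) x))"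
      proof (cases "x \<in> (\<Union>k. S k)")
        case True
        then obtain k where k: "x \<in> S k" by auto
        have "L powr - p x = (L / l k) powr - p x * l k powr - p x"
          using L l(1)[of k] by (simp add: powr_mult[symmetric])
        also have "(L / l k) powr - p x \<le> (L / l k) powr - 1"
          using L l(1)[of k] lL[of k] px by (intro powr_mono) auto
        also have "(L / l k) powr - 1 = l k / L"
          using L l(1)[of k] by (simp add: powr_minus_divide)
        finally have "L powr - p x \<le> l k / L * l k powr - p x"
          by (simp add: mult_right_mono del: times_divide_eq_left)
        then have "ennreal (L powr - p x) \<le> ennreal (l k / L) * (ennreal (l k powr - p x) * indicator (S k) x)"
          using L l(1)[of k] k by (auto simp: ennreal_mult[symmetric] intro!: ennreal_leI)
        also have "\<dots> \<le> (\<Sum>k. ennreal (l k / L) * (ennreal (l k powr - p x) * indicator (S k) x))"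
          by (rule ennreal_term_le_suminf)
        finally show ?thesis using True by simp
      qed simp
    qed
  qed
  also have "\<dots> = (\<Sum>k. ennreal (l k / L) * (\<integral>\<^sup>+x\<in>S k. ennreal (l k powr - p x) \<partial>lebesgue))"
    by (subst nn_integral_suminf) (measurable, auto intro!: suminf_cong nn_integral_cmult)
  also have "\<dots> \<le> (\<Sum>k. ennreal (l k / L) * 1)"
    by (intro suminf_le mult_left_mono l(3)) auto
  also have "\<dots> = ennreal (\<Sum>k. l k / L)"
    using L l(1) lsum by (simp add: suminf_ennreal2 less_imp_le summable_divide)
  also have "(\<Sum>k. l k / L) = 1"
    using L lsum by (simp add: suminf_divide L_def[symmetric])
  finally have "Lp_norm p (indicator (\<Union>k. S k)) \<le> ennreal L"
    using L by (intro Lp_norm_indicator_le) auto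
  also have "L \<le> suminf c + e"
    unfolding L_def sums_unique[OF dsum] by (rule suminf_le[OF l(2) lsum sums_summable[OF dsum]])
  then have "ennreal L \<le> ennreal (suminf c) + ennreal e"
    using e c by (subst ennreal_plus[symmetric]) (auto intro!: ennreal_leI suminf_nonneg)
  finally show "Lp_norm p (indicator (\<Union>k. S k)) \<le> ennreal (suminf c) + ennreal e" .
qed

lemma maximal_op_eq_HL: "maximal_op f x = enn2ereal (HL (\<lambda>y. e2ennreal \<bar>f y\<bar>) x)"
  by (simp add: maximal_op_def HL_def)

section \<open>From restricted estimates to weak Lebesgue spaces\<close>

lemma HL_le_layer_sum:
  fixes f :: "'a::euclidean_space \<Rightarrow> ennreal"
  assumes E: "\<And>k. E k \<in> sets lebesgue"
    and le: "\<And>y. f y \<le> b + (\<Sum>k. c k * indicator (E k) y)"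
  shows "HL f x \<le> b + (\<Sum>k. c k * HL (indicator (E k)) x)"
  unfolding HL_le_iff
proof (intro allI impI)
  fix t :: real assume t: "0 < t"
  note E [measurable]
  have "(\<integral>\<^sup>+y\<in>ball x t. f y \<partial>lebesgue) \<le>
      (\<integral>\<^sup>+y. b * indicator (ball x t) y + (\<Sum>k. c k * (indicator (E k) y * indicator (ball x t) y)) \<partial>lebesgue)"
  proof (rule nn_integral_mono)
    fix y show "f y * indicator (ball x t) y \<le>
      b * indicator (ball x t) y + (\<Sum>k. c k * (indicator (E k) y * indicator (ball x t) y))"
      using le[of y] by (cases "y \<in> ball x t") auto
  qed
  also have "\<dots> = (\<integral>\<^sup>+y. b * indicator (ball x t) y \<partial>lebesgue) +
      (\<integral>\<^sup>+y. (\<Sum>k. c k * (indicator (E k) y * indicator (ball x t) y)) \<partial>lebesgue)"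
    by (rule nn_integral_add) measurable
  also have "(\<integral>\<^sup>+y. b * indicator (ball x t) y \<partial>lebesgue) = b * emeasure lebesgue (ball x t)"
    by (rule nn_integral_cmult_indicator) measurable
  also have "(\<integral>\<^sup>+y. (\<Sum>k. c k * (indicator (E k) y * indicator (ball x t) y)) \<partial>lebesgue) =
     (\<Sum>k. \<integral>\<^sup>+y. c k * (indicator (E k) y * indicator (ball x t) y) \<partial>lebesgue)"
    by (rule nn_integral_suminf) measurable
  also have "\<dots> = (\<Sum>k. c k * (\<integral>\<^sup>+y\<in>ball x t. indicator (E k) y \<partial>lebesgue))"
    by (intro suminf_cong nn_integral_cmult) measurable
  also have "\<dots> \<le> (\<Sum>k. c k * HL (indicator (E k)) x * emeasure lebesgue (ball x t))"
    unfolding mult.assoc by (intro suminf_le mult_left_mono set_nn_integral_ball_le_HL t) auto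
  also have "\<dots> = (\<Sum>k. c k * HL (indicator (E k)) x) * emeasure lebesgue (ball x t)"
    by simp
  finally show "(\<integral>\<^sup>+y\<in>ball x t. f y \<partial>lebesgue) \<le>
      (b + (\<Sum>k. c k * HL (indicator (E k)) x)) * emeasure lebesgue (ball x t)"
    by (simp add: distrib_right)
qed

lemma le_geometric_layer_sum:
  fixes v :: ennreal and a D :: real
  assumes a: "0 < a" and D: "1 < D"
  shows "v \<le> ennreal a + (\<Sum>k. ennreal (D ^ Suc k * a) * of_bool (ennreal (D ^ k * a) < v))"
proof (rule dense_le)
  fix w assume wv: "w < v"
  then obtain r where r: "w = ennreal r" "0 \<le> r" by (cases w) auto
  show "w \<le> ennreal a + (\<Sum>k. ennreal (D ^ Suc k * a) * of_bool (ennreal (D ^ k * a) < v))"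
  proof (cases "r \<le> a")
    case True
    then show ?thesis using r by (simp add: ennreal_leI add_increasing2)
  next
    case False
    obtain m where "r / a < D ^ m" using real_arch_pow[OF D] by blast
    then have m: "r \<le> D ^ m * a" using a by (simp add: field_simps)
    define k where "k = (LEAST m. r \<le> D ^ m * a)"
    have k: "r \<le> D ^ k * a" unfolding k_def by (rule LeastI[of _ m]) (rule m)
    have "k \<noteq> 0" using k False by (intro notI) simp
    then obtain j where j: "k = Suc j" by (cases k) auto
    have "\<not> r \<le> D ^ j * a" using not_less_Least[of j "\<lambda>m. r \<le> D ^ m * a"] j k_def by simp
    then have "ennreal (D ^ j * a) < w" using r a D by (simp add: ennreal_less_iff)
    then have jv: "ennreal (D ^ j * a) < v" using wv by simp
    have "w \<le> ennreal (D ^ Suc j * a) * of_bool (ennreal (D ^ j * a) < v)"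
      using k j r jv by (simp add: ennreal_leI)
    also have "\<dots> \<le> (\<Sum>k. ennreal (D ^ Suc k * a) * of_bool (ennreal (D ^ k * a) < v))"
      by (rule ennreal_term_le_suminf)
    finally show ?thesis by (simp add: add_increasing)
  qed
qed

lemma sums_inverse_consecutive: "(\<lambda>k. 1 / (real (Suc k) * real (k + 2))) sums 1"
proof -
  have "(\<lambda>k. inverse (real (Suc k)) - inverse (real (Suc (Suc k)))) sums (inverse (real (Suc 0)) - 0)"
    by (rule telescope_sums'[OF LIMSEQ_inverse_real_of_nat])
  moreover have "inverse (real (Suc k)) - inverse (real (Suc (Suc k))) = 1 / (real (Suc k) * real (k + 2))" for k
    by (simp add: field_simps)
  ultimately show ?thesis by simp
qed

text \<open>
  It suffices to control the maximal functions of indicators at the thresholds \<open>1 / (D ^ (k + 1) * (k + 1) * (k + 2))\<close>.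
  Being below all these thresholds for the layers of \<open>f\<close> forces \<open>maximal_op f \<le> l\<close>, because the layer with
  index \<open>k\<close> has height \<open>D ^ (k + 1) * l / 2\<close> and the telescoping series \<open>1 / ((k + 1) * (k + 2))\<close> sums to \<open>1\<close>. The
  square in the denominator of the assumed bound makes the countable triangle inequality applicable.
\<close>

lemma bounded_weak_Lp_if_restricted:
  fixes p :: "real^'n \<Rightarrow> real" and B D :: real
  assumes p: "AE x in lebesgue. 1 \<le> p x" and pm: "p \<in> borel_measurable lebesgue"
    and D: "1 < D" and B: "0 \<le> B"
    and restr: "\<And>E k. E \<in> sets lebesgue \<Longrightarrow> Lp_norm p (indicator E) < \<infinity> \<Longrightarrow>
      Lp_norm p (indicator {x. ennreal (1 / (D ^ Suc k * (real (Suc k) * real (k + 2)))) < HL (indicator E) x})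
        \<le> ennreal (B * D ^ k / real (Suc k) ^ 2) * Lp_norm p (indicator E)"
  shows "bounded_operator_on (weak_Lp p) (weak_Lp_norm p) maximal_op"
  unfolding bounded_operator_on_def
proof (intro exI conjI ballI)
  let ?Z = "\<Sum>k. 1 / real (Suc k) ^ 2"
  have Zs: "summable (\<lambda>k. 1 / real (Suc k) ^ 2)"
    using inverse_squares_sums by (auto simp: sums_iff)
  have Z: "0 \<le> ?Z" by (intro suminf_nonneg Zs) auto
  show C0: "0 \<le> 2 * B * ?Z" using B Z by simp
  fix f assume f: "f \<in> weak_Lp p"
  then have fm [measurable]: "f \<in> borel_measurable lebesgue" and fin: "weak_Lp_norm p f < \<infinity>"
    by (auto simp: weak_Lp_def)
  define F where "F y = e2ennreal \<bar>f y\<bar>" for y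
  have Fm: "F \<in> borel_measurable lebesgue" unfolding F_def by measurable
  have HLm: "HL F \<in> borel_measurable lebesgue" by (rule borel_measurable_HL[OF Fm])
  have mop: "maximal_op f x = enn2ereal (HL F x)" for x unfolding maximal_op_eq_HL F_def ..
  obtain w where w: "weak_Lp_norm p f = ennreal w" "0 \<le> w" using fin by (cases "weak_Lp_norm p f") auto
  have key: "ennreal l * Lp_norm p (indicator {x. \<bar>maximal_op f x\<bar> > ereal l}) \<le> ennreal (2 * B * ?Z) * ennreal w"
    if l: "0 < l" for l :: real
  proof -
    define a where "a = l / 2"
    have a: "0 < a" using l by (simp add: a_def)
    define E where "E k = {x. \<bar>f x\<bar> > ereal (D ^ k * a)}" for k
    have Em: "E k \<in> sets lebesgue" for k
    proof -
      have "E k = {x\<in>space lebesgue. \<bar>f x\<bar> > ereal (D ^ k * a)}" by (auto simp: E_def)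
      also have "\<dots> \<in> sets lebesgue" by measurable
      finally show ?thesis .
    qed
    have EF: "x \<in> E k \<longleftrightarrow> ennreal (D ^ k * a) < F x" for x k
    proof -
      have "ennreal (D ^ k * a) < F x \<longleftrightarrow> enn2ereal (ennreal (D ^ k * a)) < enn2ereal (F x)"
        by (simp add: less_ennreal.rep_eq)
      also have "enn2ereal (ennreal (D ^ k * a)) = ereal (D ^ k * a)" using a D by simp
      also have "enn2ereal (F x) = \<bar>f x\<bar>" by (simp add: F_def enn2ereal_e2ennreal)
      finally show ?thesis by (simp add: E_def)
    qed
    have nE: "Lp_norm p (indicator (E k)) \<le> ennreal (w / (D ^ k * a))" for k
    proof -
      have "ennreal (D ^ k * a) * Lp_norm p (indicator (E k)) \<le> ennreal w"
        unfolding w(1)[symmetric] weak_Lp_norm_def E_def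
        by (rule SUP_upper) (use a D in auto)
      then show ?thesis by (rule ennreal_le_divide_if_mult_le[rotated 2]) (use a D w in auto)
    qed
    define T where "T k = {x. ennreal (1 / (D ^ Suc k * (real (Suc k) * real (k + 2)))) < HL (indicator (E k)) x}" for k
    have Tm: "T k \<in> sets lebesgue" for k
      unfolding T_def using open_HL_superlevel[of "indicator (E k)"] Em by (auto intro: borel_open)
    have nT: "Lp_norm p (indicator (T k)) \<le> ennreal (2 * B * w / l * (1 / real (Suc k) ^ 2))" for k
    proof -
      have "Lp_norm p (indicator (T k)) \<le> ennreal (B * D ^ k / real (Suc k) ^ 2) * Lp_norm p (indicator (E k))"
        unfolding T_def by (rule restr[OF Em]) (use nE[of k] in \<open>auto simp: le_less_trans\<close>)
      also have "\<dots> \<le> ennreal (B * D ^ k / real (Suc k) ^ 2) * ennreal (w / (D ^ k * a))"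
        by (rule mult_left_mono[OF nE]) simp
      also have "\<dots> = ennreal (B * D ^ k / real (Suc k) ^ 2 * (w / (D ^ k * a)))"
        using B D a w by (intro ennreal_mult[symmetric]) auto
      also have "B * D ^ k / real (Suc k) ^ 2 * (w / (D ^ k * a)) = 2 * B * w / l * (1 / real (Suc k) ^ 2)"
        using D l by (simp add: a_def mult_ac)
      finally show ?thesis .
    qed
    have sub: "{x. \<bar>maximal_op f x\<bar> > ereal l} \<subseteq> (\<Union>k. T k)"
    proof
      fix x assume "x \<in> {x. \<bar>maximal_op f x\<bar> > ereal l}"
      then have "ereal l < enn2ereal (HL F x)" by (simp add: mop)
      moreover have "ereal l = enn2ereal (ennreal l)" using l by simp
      ultimately have x: "ennreal l < HL F x" by (simp add: less_ennreal.rep_eq)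
      show "x \<in> (\<Union>k. T k)"
      proof (rule ccontr)
        assume "x \<notin> (\<Union>k. T k)"
        then have small: "HL (indicator (E k)) x \<le> ennreal (1 / (D ^ Suc k * (real (Suc k) * real (k + 2))))" for k
          by (auto simp: T_def not_less)
        have "HL F x \<le> ennreal a + (\<Sum>k. ennreal (D ^ Suc k * a) * HL (indicator (E k)) x)"
        proof (rule HL_le_layer_sum[OF Em])
          fix y
          have "indicator (E k) y = (of_bool (ennreal (D ^ k * a) < F y) :: ennreal)" for k
            using EF[of y k] by (auto simp: indicator_def)
          then show "F y \<le> ennreal a + (\<Sum>k. ennreal (D ^ Suc k * a) * indicator (E k) y)"
            using le_geometric_layer_sum[OF a D, of "F y"] by simp
        qed
        also have "\<dots> \<le> ennreal a + (\<Sum>k. ennreal (D ^ Suc k * a) * ennreal (1 / (D ^ Suc k * (real (Suc k) * real (k + 2)))))"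
          by (intro add_left_mono suminf_le mult_left_mono small) auto
        also have "(\<lambda>k. ennreal (D ^ Suc k * a) * ennreal (1 / (D ^ Suc k * (real (Suc k) * real (k + 2)))))
            = (\<lambda>k. ennreal (a * (1 / (real (Suc k) * real (k + 2)))))"
        proof
          fix k
          have "ennreal (D ^ Suc k * a) * ennreal (1 / (D ^ Suc k * (real (Suc k) * real (k + 2))))
             = ennreal (D ^ Suc k * a * (1 / (D ^ Suc k * (real (Suc k) * real (k + 2)))))"
            using a D by (intro ennreal_mult[symmetric]) auto
          also have "D ^ Suc k * a * (1 / (D ^ Suc k * (real (Suc k) * real (k + 2)))) = a * (1 / (real (Suc k) * real (k + 2)))"
            using D by simp
          finally show "ennreal (D ^ Suc k * a) * ennreal (1 / (D ^ Suc k * (real (Suc k) * real (k + 2))))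
             = ennreal (a * (1 / (real (Suc k) * real (k + 2))))" .
        qed
        also have "(\<Sum>k. ennreal (a * (1 / (real (Suc k) * real (k + 2))))) = ennreal (a * 1)"
          using sums_mult[OF sums_inverse_consecutive, of a] a by (intro suminf_ennreal_eq) auto
        also have "ennreal a + ennreal (a * 1) = ennreal l"
          using a by (simp add: ennreal_plus[symmetric] a_def del: ennreal_plus)
        finally show False using x by simp
      qed
    qed
    have "Lp_norm p (indicator {x. \<bar>maximal_op f x\<bar> > ereal l}) \<le> Lp_norm p (indicator (\<Union>k. T k))"
      by (rule Lp_norm_indicator_mono[OF sub])
    also have "\<dots> \<le> ennreal (\<Sum>k. 2 * B * w / l * (1 / real (Suc k) ^ 2))"
      by (rule Lp_norm_indicator_Union_le[OF p pm Tm nT]) (use B w l in simp, rule summable_mult[OF Zs])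
    also have "(\<Sum>k. 2 * B * w / l * (1 / real (Suc k) ^ 2)) = 2 * B * w / l * ?Z"
      by (rule suminf_mult[OF Zs])
    finally have "ennreal l * Lp_norm p (indicator {x. \<bar>maximal_op f x\<bar> > ereal l}) \<le> ennreal l * ennreal (2 * B * w / l * ?Z)"
      by (rule mult_left_mono) simp
    also have "\<dots> = ennreal (l * (2 * B * w / l * ?Z))"
      using l B w Z by (intro ennreal_mult[symmetric]) auto
    also have "l * (2 * B * w / l * ?Z) = (2 * B * ?Z) * w" using l by simp
    also have "ennreal \<dots> = ennreal (2 * B * ?Z) * ennreal w" by (rule ennreal_mult[OF C0 w(2)])
    finally show ?thesis .
  qed
  then show le: "weak_Lp_norm p (maximal_op f) \<le> ennreal (2 * B * ?Z) * weak_Lp_norm p f"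
    unfolding w(1) by (subst weak_Lp_norm_def) (auto intro!: SUP_least)
  have "maximal_op f \<in> borel_measurable lebesgue"
    using HLm unfolding mop[abs_def] by measurable
  moreover have "weak_Lp_norm p (maximal_op f) < \<infinity>"
    using le unfolding w(1) by (rule le_less_trans) (simp add: ennreal_mult_less_top)
  ultimately show "maximal_op f \<in> weak_Lp p" by (simp add: weak_Lp_def)
qed


section \<open>Exponents with a bounded maximal operator\<close>

lemma Lp_norm_indicator_le_if_ge:
  assumes p: "AE x in lebesgue. 1 \<le> p x" and c: "0 < c"
    and ge: "\<And>x. x \<in> S \<Longrightarrow> ereal c \<le> \<bar>g x\<bar>"
  shows "ennreal c * Lp_norm p (indicator S) \<le> Lp_norm p g"
  unfolding Lp_norm_def[of p g]
proof (rule Inf_greatest, safe)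
  fix l :: real assume l: "0 < l" "modular p (\<lambda>x. g x / ereal l) \<le> 1"
  have "(\<integral>\<^sup>+x\<in>S. ennreal ((l / c) powr - p x) \<partial>lebesgue) \<le> modular p (\<lambda>x. g x / ereal l)"
    unfolding modular_def
  proof (rule nn_integral_mono_AE)
    show "AE x in lebesgue. ennreal ((l / c) powr - p x) * indicator S x \<le> abs_powr (g x / ereal l) (p x)"
      using p
    proof eventually_elim
      fix x assume px: "1 \<le> p x"
      show "ennreal ((l / c) powr - p x) * indicator S x \<le> abs_powr (g x / ereal l) (p x)"
      proof (cases "x \<in> S \<and> \<bar>g x\<bar> \<noteq> \<infinity>")
        case True
        then obtain r where r: "g x = ereal r" by (cases "g x") auto
        have "c \<le> \<bar>r\<bar>" using ge[of x] True r by simp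
        then have "c / l \<le> \<bar>r / l\<bar>" using l(1) by (simp add: divide_right_mono)
        have "(l / c) powr - p x = (c / l) powr p x"
          using l c by (simp add: powr_divide powr_minus field_simps)
        also have "\<dots> \<le> \<bar>r / l\<bar> powr p x"
          using \<open>c / l \<le> \<bar>r / l\<bar>\<close> c l px by (intro powr_mono2) auto
        finally show ?thesis using True r l by (simp add: abs_powr_def ennreal_leI)
      next
        case False
        then show ?thesis using l by (cases "x \<in> S"; cases "g x") (auto simp: abs_powr_def)
      qed
    qed
  qed
  then have "Lp_norm p (indicator S) \<le> ennreal (l / c)"
    using l c by (intro Lp_norm_indicator_le) auto
  then have "ennreal c * Lp_norm p (indicator S) \<le> ennreal c * ennreal (l / c)"
    by (rule mult_left_mono) simp
  also have "\<dots> = ennreal l" using c l by (simp add: ennreal_mult[symmetric])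
  finally show "ennreal c * Lp_norm p (indicator S) \<le> ennreal l" .
qed

text \<open>
  A finite Luxemburg norm of an indicator forces finite measure when the exponent is bounded above.
\<close>

lemma emeasure_le_exponent_integral:
  assumes p: "AE x in lebesgue. 1 \<le> p x" and pm: "p \<in> borel_measurable lebesgue"
    and P: "\<And>x. p x \<le> P" and E: "E \<in> sets lebesgue" and l: "0 < l"
  shows "emeasure lebesgue E \<le>
    ennreal (max 1 l powr P) * (\<integral>\<^sup>+x\<in>E. ennreal (l powr - p x) \<partial>lebesgue)"
proof -
  note pm [measurable] E [measurable]
  have "emeasure lebesgue E = (\<integral>\<^sup>+x. indicator E x \<partial>lebesgue)" by simp
  also have "\<dots> \<le> (\<integral>\<^sup>+x. ennreal (max 1 l powr P) * (ennreal (l powr - p x) * indicator E x) \<partial>lebesgue)"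
  proof (rule nn_integral_mono_AE)
    show "AE x in lebesgue. indicator E x
      \<le> ennreal (max 1 l powr P) * (ennreal (l powr - p x) * indicator E x)"
      using p
    proof eventually_elim
      fix x assume px: "1 \<le> p x"
      have "l powr p x \<le> max 1 l powr p x" using l px by (intro powr_mono2) auto
      also have "\<dots> \<le> max 1 l powr P" using P[of x] by (intro powr_mono) auto
      finally have "l powr p x * l powr - p x \<le> max 1 l powr P * l powr - p x"
        by (rule mult_right_mono) simp
      moreover have "l powr p x * l powr - p x = 1" using l by (simp add: powr_add[symmetric])
      ultimately have "ennreal 1 \<le> ennreal (max 1 l powr P * l powr - p x)"
        by (intro ennreal_leI) simp
      then show "indicator E x
          \<le> ennreal (max 1 l powr P) * (ennreal (l powr - p x) * indicator E x)"
        by (auto simp: indicator_def ennreal_mult)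
    qed
  qed
  also have "\<dots> = ennreal (max 1 l powr P) * (\<integral>\<^sup>+x\<in>E. ennreal (l powr - p x) \<partial>lebesgue)"
    by (rule nn_integral_cmult) measurable
  finally show ?thesis .
qed

lemma indicator_in_Lp:
  assumes p: "AE x in lebesgue. 1 \<le> p x" and pm: "p \<in> borel_measurable lebesgue"
    and P: "\<And>x. p x \<le> P" and E: "E \<in> sets lebesgue" and fin: "Lp_norm p (indicator E) < \<infinity>"
  shows "indicator E \<in> Lp p"
proof -
  obtain l where l: "0 < l" "(\<integral>\<^sup>+x\<in>E. ennreal (l powr - p x) \<partial>lebesgue) \<le> 1"
    using fin by (rule Lp_norm_indicator_lessE)
  have "modular p (indicator E) = modular p (\<lambda>x. indicator E x / ereal 1)"
    by (simp flip: one_ereal_def)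
  also have "\<dots> = emeasure lebesgue E"
    using E by (subst modular_indicator_div) simp_all
  also have "\<dots> \<le> ennreal (max 1 l powr P) * (\<integral>\<^sup>+x\<in>E. ennreal (l powr - p x) \<partial>lebesgue)"
    by (rule emeasure_le_exponent_integral[OF p pm P E l(1)])
  also have "\<dots> \<le> ennreal (max 1 l powr P) * 1"
    by (rule mult_left_mono[OF l(2)]) simp
  also have "\<dots> < \<infinity>" by simp
  finally show ?thesis using E by (simp add: Lp_def)
qed

text \<open>
  The iterates of \<open>HL\<close> on an indicator are those of \<open>maximal_op\<close>, since absolute values and conversions have no
  effect on nonnegative functions.
\<close>

lemma HL_iterate_bounded_on_Lp:
  fixes p :: "real^'n \<Rightarrow> real"
  assumes A: "0 \<le> A" "\<And>f. f \<in> Lp p \<Longrightarrow> maximal_op f \<in> Lp p \<and> Lp_norm p (maximal_op f) \<le> ennreal A * Lp_norm p f"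
    and E: "indicator E \<in> Lp p"
  shows "(\<lambda>x. enn2ereal ((HL ^^ j) (indicator E) x)) \<in> Lp p \<and>
    Lp_norm p (\<lambda>x. enn2ereal ((HL ^^ j) (indicator E) x)) \<le> ennreal (A ^ j) * Lp_norm p (indicator E)"
proof (induction j)
  case 0
  have "(\<lambda>x. enn2ereal (indicator E x)) = indicator E"
    by (auto simp: indicator_def zero_ennreal.rep_eq one_ennreal.rep_eq)
  then show ?case using E by simp
next
  case (Suc j)
  let ?g = "\<lambda>x. enn2ereal ((HL ^^ j) (indicator E) x)"
  have "maximal_op ?g = (\<lambda>x. enn2ereal ((HL ^^ Suc j) (indicator E) x))"
    by (rule ext) (simp add: maximal_op_eq_HL e2ennreal_enn2ereal)
  moreover have "Lp_norm p (maximal_op ?g) \<le> ennreal A * Lp_norm p ?g"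
    using A(2) Suc.IH by blast
  moreover have "ennreal A * Lp_norm p ?g \<le> ennreal A * (ennreal (A ^ j) * Lp_norm p (indicator E))"
    using Suc.IH by (intro mult_left_mono) auto
  moreover have "ennreal A * (ennreal (A ^ j) * Lp_norm p (indicator E)) = ennreal (A ^ Suc j) * Lp_norm p (indicator E)"
    using A(1) by (simp add: ennreal_mult mult.assoc)
  ultimately show ?case using A(2)[of ?g] Suc.IH by auto
qed

lemma square_le_two_power: "11 \<le> k \<Longrightarrow> (real k + 1) ^ 2 \<le> 4 * 2 ^ k"
proof (induction k rule: dec_induct)
  case (step k)
  then have "11 * 11 \<le> real k * real k" by (intro mult_mono) auto
  then have "(real (Suc k) + 1) ^ 2 \<le> 2 * (real k + 1) ^ 2"
    by (simp add: power2_eq_square algebra_simps)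
  with step.IH show ?case by simp
qed simp

text \<open>
  The logarithmic gain at the thresholds used for the layers. The lemma \<open>HL_iterate_ge_log_gain\<close> is applied with
  \<open>j = 4\<close>, hence six iterates, and \<open>u = k\<close>. The choice \<open>D = q ^ 2\<close> for \<open>q = 2 ^ DIM('a)\<close> leaves room in its first
  alternative: \<open>(1/q) ^ k\<close> is much larger than \<open>1 / D ^ k\<close>. For small \<open>k\<close> the binomial coefficient gives nothing,
  and monotonicity of the iterates is used instead, at the price of a small constant.
\<close>

lemma HL_iterate_polynomial_gain:
  fixes D :: real
  defines "D \<equiv> 4 ^ DIM('a::euclidean_space)"
  shows "\<exists>c>0. \<forall>E\<in>sets lebesgue. \<forall>(k::nat) (x::'a).
    ennreal (1 / (D ^ Suc k * (real (Suc k) * real (k + 2)))) < HL (indicator E) x \<longrightarrow>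
    ennreal (c * real (Suc k) ^ 4 * (1 / (D ^ Suc k * (real (Suc k) * real (k + 2))))) \<le> (HL ^^ 6) (indicator E) x"
proof -
  define q where "q = (2::real) ^ DIM('a)"
  have q: "2 \<le> q" unfolding q_def using self_le_power[of "2::real" "DIM('a)"] by simp
  have "(4::real) = 2 ^ 2" by simp
  then have Dq: "D = q ^ 2" unfolding D_def q_def by (metis power_mult mult.commute)
  define \<kappa> where "\<kappa> = 1 / (2 * 5 ^ DIM('a) * q ^ 2)"
  have "1 * (1::real) \<le> 5 ^ DIM('a) * q ^ 2" using q by (intro mult_mono) (auto simp: one_le_power)
  then have \<kappa>: "0 < \<kappa>" "\<kappa> \<le> 1" using q by (auto simp: \<kappa>_def divide_le_eq)
  \<comment> \<open>The divisor makes \<open>c * (k + 1) ^ 4 \<le> 1\<close> for \<open>k \<le> 10\<close>; it is also larger than the \<open>8 ^ 4\<close> lost below.\<close>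
  define c where "c = \<kappa> ^ 5 / 11 ^ 4"
  have \<kappa>5: "\<kappa> ^ 5 \<le> 1" using \<kappa> by (intro power_le_one) auto
  have c: "0 < c" "c * 11 ^ 4 \<le> 1" "c \<le> 1" "c * 8 ^ 4 \<le> \<kappa> ^ 5" using \<kappa> \<kappa>5 by (auto simp: c_def)
  show ?thesis
  proof (intro exI[of _ c] conjI ballI allI impI)
    fix E :: "'a set" and k :: nat and x :: 'a
    assume E: "E \<in> sets lebesgue"
    define t where "t = 1 / (D ^ Suc k * (real (Suc k) * real (k + 2)))"
    assume "ennreal (1 / (D ^ Suc k * (real (Suc k) * real (k + 2)))) < HL (indicator E) x"
    then have tx: "ennreal t < HL (indicator E) x" by (simp only: t_def)
    have t: "0 < t" unfolding t_def D_def by simp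
    have "ennreal (c * real (Suc k) ^ 4 * t) \<le> (HL ^^ 6) (indicator E) x"
    proof (cases "k \<le> 10")
      case True
      have "c * real (Suc k) ^ 4 \<le> c * 11 ^ 4"
        using True c(1) by (intro mult_left_mono power_mono) auto
      also note c(2)
      finally have "c * real (Suc k) ^ 4 * t \<le> 1 * t" using t by (intro mult_right_mono) auto
      then have "ennreal (c * real (Suc k) ^ 4 * t) \<le> ennreal t" by (simp only: mult_1 ennreal_leI)
      also have "\<dots> \<le> HL (indicator E) x" using tx by (rule less_imp_le)
      also have "\<dots> = (HL ^^ 1) (indicator E) x" by simp
      also have "\<dots> \<le> (HL ^^ 6) (indicator E) x" using E by (intro HL_iterate_incseq) auto
      finally show ?thesis .
    next
      case False
      then have k: "11 \<le> k" by simp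
      have gain: "ennreal (min ((1/q) ^ k) (\<kappa> ^ Suc 4 * real (k - Suc 4 choose 4) * t)) \<le> (HL ^^ (4 + 2)) (indicator E) x"
        unfolding q_def \<kappa>_def by (rule HL_iterate_ge_log_gain[OF E t tx]) (use k in simp)
      have "c * real (Suc k) ^ 4 * t \<le> \<kappa> ^ Suc 4 * real (k - Suc 4 choose 4) * t"
      proof (rule mult_right_mono)
        \<comment> \<open>This is where \<open>k \<ge> 11\<close> is used: it gives \<open>k - 5 \<ge> (k + 1) / 2\<close>.\<close>
        have "real (Suc k) / 8 \<le> real (k - 5) / 4" using k by simp
        then have "(real (Suc k) / 8) ^ 4 \<le> (real (k - 5) / 4) ^ 4" by (intro power_mono) auto
        also have "\<dots> \<le> real (k - 5 choose 4)"
          using binomial_ge_n_over_k_pow_k[of 4 "k - 5", where 'a = real] k by simp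
        finally have *: "(real (Suc k) / 8) ^ 4 \<le> real (k - 5 choose 4)" .
        have "c * real (Suc k) ^ 4 = (c * 8 ^ 4) * (real (Suc k) / 8) ^ 4" by (simp add: power_divide)
        also have "\<dots> \<le> \<kappa> ^ 5 * real (k - 5 choose 4)"
          using c \<kappa> by (intro mult_mono *) auto
        finally show "c * real (Suc k) ^ 4 \<le> \<kappa> ^ Suc 4 * real (k - Suc 4 choose 4)" by simp
      qed (use t in simp)
      moreover have "c * real (Suc k) ^ 4 * t \<le> (1/q) ^ k"
      proof -
        have "c * real (Suc k) ^ 4 * t \<le> real (Suc k) ^ 4 * t"
          using c t by (simp add: mult_right_mono mult_left_le_one_le)
        also have "\<dots> = real (Suc k) ^ 3 / real (k + 2) / D ^ Suc k"
          by (simp add: t_def power4_eq_xxxx power3_eq_cube mult_ac)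
        also have "\<dots> \<le> real (Suc k) ^ 2 / D ^ Suc k"
        proof (rule divide_right_mono)
          have "real (Suc k) ^ 3 = real (Suc k) ^ 2 * real (Suc k)" by (simp add: power3_eq_cube power2_eq_square)
          also have "\<dots> \<le> real (Suc k) ^ 2 * real (k + 2)" by (intro mult_left_mono) auto
          finally show "real (Suc k) ^ 3 / real (k + 2) \<le> real (Suc k) ^ 2"
            by (simp add: divide_le_eq)
        qed (simp add: D_def)
        also have "\<dots> \<le> q ^ (k + 2) / D ^ Suc k"
        proof (rule divide_right_mono)
          have "real (Suc k) ^ 2 \<le> 2 ^ (k + 2)" using square_le_two_power[OF k] by (simp add: add.commute)
          also have "\<dots> \<le> q ^ (k + 2)" using q by (intro power_mono) auto
          finally show "real (Suc k) ^ 2 \<le> q ^ (k + 2)" .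
        qed (simp add: D_def)
        also have "D ^ Suc k = q ^ (k + 2) * q ^ k"
          unfolding Dq power_mult[symmetric] power_add[symmetric] by (rule arg_cong[where f = "power q"]) simp
        also have "q ^ (k + 2) / (q ^ (k + 2) * q ^ k) = (1/q) ^ k"
          using q by (simp add: power_divide)
        finally show ?thesis .
      qed
      ultimately have "ennreal (c * real (Suc k) ^ 4 * t) \<le> ennreal (min ((1/q) ^ k) (\<kappa> ^ Suc 4 * real (k - Suc 4 choose 4) * t))"
        by (intro ennreal_leI) simp
      also note gain
      finally show ?thesis by simp
    qed
    then show "ennreal (c * real (Suc k) ^ 4 * (1 / (D ^ Suc k * (real (Suc k) * real (k + 2))))) \<le> (HL ^^ 6) (indicator E) x"
      by (simp only: t_def)
  qed (rule c(1))
qed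

text \<open>
  On the set where \<open>HL (indicator E)\<close> exceeds the threshold \<open>t\<close>, the sixth iterate is at least a multiple of
  \<open>(k + 1) ^ 4 * t\<close>, while its norm is at most the sixth power of the operator norm times that of the indicator.
  Comparing the two gives the restricted estimate.
\<close>

lemma bounded_weak_Lp_if_bounded_Lp:
  fixes p :: "real^'n \<Rightarrow> real"
  assumes p: "AE x in lebesgue. 1 \<le> p x" and pm: "p \<in> borel_measurable lebesgue"
    and P: "\<And>x. p x \<le> P"
    and bd: "bounded_operator_on (Lp p) (Lp_norm p) maximal_op"
  shows "bounded_operator_on (weak_Lp p) (weak_Lp_norm p) maximal_op"
proof -
  define D :: real where "D = 4 ^ DIM(real^'n)"
  have D: "1 < D" unfolding D_def by (rule one_less_power) auto
  obtain A where A: "0 \<le> A"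
    "\<And>f. f \<in> Lp p \<Longrightarrow> maximal_op f \<in> Lp p \<and> Lp_norm p (maximal_op f) \<le> ennreal A * Lp_norm p f"
    using bd unfolding bounded_operator_on_def by auto
  obtain c where c: "0 < c" and gain: "\<And>E k (x :: real^'n). E \<in> sets lebesgue \<Longrightarrow>
      ennreal (1 / (D ^ Suc k * (real (Suc k) * real (k + 2)))) < HL (indicator E) x \<Longrightarrow>
      ennreal (c * real (Suc k) ^ 4 * (1 / (D ^ Suc k * (real (Suc k) * real (k + 2))))) \<le> (HL ^^ 6) (indicator E) x"
    using HL_iterate_polynomial_gain[where 'a = "real^'n"] unfolding D_def by blast
  show ?thesis
  proof (rule bounded_weak_Lp_if_restricted[OF p pm D, of "2 * D * A ^ 6 / c"])
    show "0 \<le> 2 * D * A ^ 6 / c" using A c D by simp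
    fix E :: "(real^'n) set" and k :: nat
    assume E: "E \<in> sets lebesgue" and fin: "Lp_norm p (indicator E) < \<infinity>"
    define t where "t = 1 / (D ^ Suc k * (real (Suc k) * real (k + 2)))"
    define s where "s = c * real (Suc k) ^ 4 * t"
    have t: "0 < t" unfolding t_def D_def by simp
    have s: "0 < s" using c t by (simp add: s_def)
    let ?g = "\<lambda>x. enn2ereal ((HL ^^ 6) (indicator E) x)"
    obtain e where e: "Lp_norm p (indicator E) = ennreal e" "0 \<le> e"
      using fin by (cases "Lp_norm p (indicator E)") auto
    have "ennreal s * Lp_norm p (indicator {x. ennreal t < HL (indicator E) x}) \<le> Lp_norm p ?g"
    proof (rule Lp_norm_indicator_le_if_ge[OF p s])
      fix x assume "x \<in> {x. ennreal t < HL (indicator E) x}"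
      then have "ennreal s \<le> (HL ^^ 6) (indicator E) x"
        unfolding s_def t_def by (intro gain[OF E]) simp
      then have "enn2ereal (ennreal s) \<le> ?g x" by (simp add: less_eq_ennreal.rep_eq)
      then show "ereal s \<le> \<bar>?g x\<bar>" using s by simp
    qed
    also have "\<dots> \<le> ennreal (A ^ 6) * Lp_norm p (indicator E)"
      using HL_iterate_bounded_on_Lp[OF A indicator_in_Lp[OF p pm P E fin], of 6] by simp
    also have "\<dots> = ennreal (A ^ 6 * e)" using A e by (simp add: ennreal_mult)
    finally have "Lp_norm p (indicator {x. ennreal t < HL (indicator E) x}) \<le> ennreal (A ^ 6 * e / s)"
      by (rule ennreal_le_divide_if_mult_le[rotated 2]) (use s A e in auto)
    also have "\<dots> \<le> ennreal (2 * D * A ^ 6 / c * D ^ k / real (Suc k) ^ 2 * e)"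
    proof (rule ennreal_leI)
      have "A ^ 6 * e / s = A ^ 6 * e / c * (D ^ Suc k * (real (k + 2) / real (Suc k) ^ 3))"
        by (simp add: s_def t_def power4_eq_xxxx power3_eq_cube mult_ac)
      also have "\<dots> \<le> A ^ 6 * e / c * (D ^ Suc k * (2 / real (Suc k) ^ 2))"
      proof (intro mult_left_mono)
        have "real (k + 2) / real (Suc k) ^ 3 = (real (k + 2) / real (Suc k)) / real (Suc k) ^ 2"
          by (simp add: power3_eq_cube power2_eq_square)
        also have "\<dots> \<le> 2 / real (Suc k) ^ 2" by (intro divide_right_mono) (auto simp: field_simps)
        finally show "real (k + 2) / real (Suc k) ^ 3 \<le> 2 / real (Suc k) ^ 2" .
      qed (use A e c D in auto)
      also have "\<dots> = 2 * D * A ^ 6 / c * D ^ k / real (Suc k) ^ 2 * e" by simp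
      finally show "A ^ 6 * e / s \<le> 2 * D * A ^ 6 / c * D ^ k / real (Suc k) ^ 2 * e" .
    qed
    also have "\<dots> = ennreal (2 * D * A ^ 6 / c * D ^ k / real (Suc k) ^ 2) * Lp_norm p (indicator E)"
      unfolding e(1) using A c D e(2) by (intro ennreal_mult) auto
    finally show "Lp_norm p (indicator {x. ennreal (1 / (D ^ Suc k * (real (Suc k) * real (k + 2)))) < HL (indicator E) x})
        \<le> ennreal (2 * D * A ^ 6 / c * D ^ k / real (Suc k) ^ 2) * Lp_norm p (indicator E)"
      unfolding t_def .
  qed
qed


section \<open>Log-Hoelder continuous exponents\<close>

text \<open>
  On points at distance of the order of \<open>\<rho>\<close>, the oscillation of \<open>p\<close> is at most of the order of
  \<open>1 / ln (1 / \<rho>)\<close>, and \<open>- ln L\<close> is at most of the order of \<open>ln (1 / \<rho>)\<close> because \<open>L\<close> is bounded below by the volume of a ball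
  of radius \<open>\<rho>\<close>. The product of both stays bounded.
\<close>

lemma local_exponent_comparison:
  fixes p :: "real^'n \<Rightarrow> real"
  assumes hol: "\<And>x y. \<bar>p x - p y\<bar> \<le> c / ln (exp 1 + 1 / norm (x - y))" and c: "0 < c"
    and L: "0 < L" "L \<le> 1" and \<omega>: "0 < \<omega>" and \<rho>: "0 < \<rho>" "\<omega> * \<rho> ^ n \<le> L" and xy: "dist x y \<le> 6 * \<rho>"
  shows "L powr - p x \<le> exp (c * (\<bar>ln \<omega>\<bar> + 6 * real n)) * L powr - p y"
proof -
  have "(p x - p y) * - ln L \<le> c * (\<bar>ln \<omega>\<bar> + 6 * real n)"
  proof (cases "x = y")
    case True
    then show ?thesis using c by simp
  next
    case False
    define w where "w = norm (x - y)"
    define s where "s = ln (exp 1 + 1 / w)"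
    have w: "0 < w" "w \<le> 6 * \<rho>" using False xy by (auto simp: w_def dist_norm)
    have "ln (exp (1::real)) \<le> s" unfolding s_def using w by (intro ln_mono) (auto intro!: add_pos_pos)
    then have s1: "1 \<le> s" by simp
    have "ln (1 / w) \<le> s" unfolding s_def using w by (intro ln_mono) (auto intro!: add_pos_pos)
    then have sw: "- ln w \<le> s" using w by (simp add: ln_div)
    have "ln w \<le> ln (6 * \<rho>)" using w \<rho> by (intro ln_mono) auto
    then have "ln w \<le> ln 6 + ln \<rho>" using \<rho> by (simp add: ln_mult)
    moreover have "ln (6::real) \<le> 5" using ln_le_minus_one[of 6] by simp
    ultimately have "- ln \<rho> \<le> 5 + s" using sw by simp
    moreover have "ln (\<omega> * \<rho> ^ n) \<le> ln L" using \<rho> \<omega> L by (intro ln_mono) auto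
    then have "- ln L \<le> - ln \<omega> + real n * (- ln \<rho>)" using \<omega> \<rho> by (simp add: ln_mult ln_realpow)
    ultimately have "- ln L \<le> \<bar>ln \<omega>\<bar> + real n * (5 + s)"
      by (smt (verit) mult_left_mono of_nat_0_le_iff)
    also have "\<dots> \<le> \<bar>ln \<omega>\<bar> * s + real n * (5 * s + s)"
      using s1 mult_left_mono[of 1 s "\<bar>ln \<omega>\<bar>"] by (intro add_mono mult_left_mono) auto
    also have "\<dots> = (\<bar>ln \<omega>\<bar> + 6 * real n) * s" by (simp add: algebra_simps)
    finally have Ls: "- ln L \<le> (\<bar>ln \<omega>\<bar> + 6 * real n) * s" .
    have "(p x - p y) * - ln L \<le> (c / s) * - ln L"
      using hol[of x y] L by (intro mult_right_mono) (auto simp: s_def w_def)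
    also have "\<dots> \<le> (c / s) * ((\<bar>ln \<omega>\<bar> + 6 * real n) * s)"
      using c s1 by (intro mult_left_mono Ls) auto
    also have "\<dots> = c * (\<bar>ln \<omega>\<bar> + 6 * real n)" using s1 by simp
    finally show ?thesis .
  qed
  then show ?thesis using L by (simp add: powr_def exp_add[symmetric] algebra_simps)
qed

text \<open>
  Outside a ball of radius \<open>L powr \<delta>\<close>, the exponent differs from its limit by at most \<open>c / (\<delta> * ln L)\<close>.
\<close>

lemma global_exponent_comparison:
  fixes p :: "real^'n \<Rightarrow> real"
  assumes dec: "\<And>x. \<bar>p x - pinf\<bar> \<le> c / ln (exp 1 + norm x)" and c: "0 < c"
    and L: "1 \<le> L" and \<delta>: "0 < \<delta>" and x: "L powr \<delta> \<le> norm x" and y: "L powr \<delta> \<le> norm y"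
  shows "L powr - p x \<le> exp (2 * c / \<delta>) * L powr - p y"
proof -
  have *: "\<bar>p z - pinf\<bar> * ln L \<le> c / \<delta>" if z: "L powr \<delta> \<le> norm z" for z
  proof -
    define s where "s = ln (exp 1 + norm z)"
    have "ln (exp (1::real)) \<le> s" unfolding s_def by (intro ln_mono) (auto intro!: add_pos_nonneg)
    then have s1: "1 \<le> s" by simp
    have "ln (L powr \<delta>) \<le> s" unfolding s_def using z L
      by (intro ln_mono) (auto intro!: add_pos_nonneg add_increasing)
    then have sL: "ln L \<le> s / \<delta>" using L \<delta> by (simp add: field_simps)
    have "\<bar>p z - pinf\<bar> * ln L \<le> (c / s) * (s / \<delta>)"
      using dec[of z] L sL s1 c by (intro mult_mono) (auto simp: s_def)
    also have "\<dots> = c / \<delta>" using s1 by simp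
    finally show ?thesis .
  qed
  have "(p y - p x) * ln L \<le> (\<bar>p y - pinf\<bar> + \<bar>p x - pinf\<bar>) * ln L"
    using L by (intro mult_right_mono) auto
  also have "\<dots> \<le> 2 * c / \<delta>" using *[OF x] *[OF y] by (simp add: distrib_right)
  finally show ?thesis using L by (simp add: powr_def exp_add[symmetric] algebra_simps)
qed

text \<open>
  Balls in which \<open>E\<close> has density above \<open>t\<close> cover the superlevel set, and the Vitali lemma extracts disjoint ones
  whose fivefold enlargements still cover. The radii are bounded, as the lemma requires, because \<open>E\<close> has finite
  measure.
\<close>

lemma HL_indicator_covering_estimate:
  fixes E :: "'a::euclidean_space set"
  assumes E: "E \<in> sets lebesgue" "emeasure lebesgue E < \<infinity>" and t: "0 < t"
    and g: "g \<in> borel_measurable lebesgue" and h: "h \<in> borel_measurable lebesgue"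
    and ball: "\<And>x r. 0 < r \<Longrightarrow> ennreal t * emeasure lebesgue (ball x r) < emeasure lebesgue (E \<inter> ball x r) \<Longrightarrow>
      (\<integral>\<^sup>+y\<in>ball x (5 * r). g y \<partial>lebesgue) \<le> K * (\<integral>\<^sup>+y\<in>E \<inter> ball x r. h y \<partial>lebesgue)"
  shows "(\<integral>\<^sup>+x\<in>{x. ennreal t < HL (indicator E) x}. g x \<partial>lebesgue) \<le> K * (\<integral>\<^sup>+y\<in>E. h y \<partial>lebesgue)"
proof -
  note E(1) [measurable] g [measurable] h [measurable]
  define S where "S = {x. ennreal t < HL (indicator E) x}"
  define Q where "Q x r \<longleftrightarrow> 0 < r \<and> ennreal t * emeasure lebesgue (ball x r) < emeasure lebesgue (E \<inter> ball x r)" for x r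
  have ind: "(\<integral>\<^sup>+y\<in>ball x r. indicator E y \<partial>lebesgue) = emeasure lebesgue (E \<inter> ball x r)" for x r
    by (simp add: indicator_inter_arith[symmetric])
  have "\<forall>x\<in>S. \<exists>r. Q x r"
    by (auto simp: S_def Q_def less_HL_iff ind)
  then obtain r where r: "\<forall>x\<in>S. Q x (r x)" by (rule bchoice[THEN exE])
  obtain m where m: "emeasure lebesgue E = ennreal m" "0 \<le> m"
    using E(2) by (cases "emeasure lebesgue E") auto
  define \<omega> where "\<omega> = unit_ball_vol (real DIM('a))"
  have \<omega>: "0 < \<omega>" by (simp add: \<omega>_def)
  have rB: "0 < r x \<and> r x \<le> max 1 (m / (t * \<omega>))" if x: "x \<in> S" for x
  proof -
    have rx: "0 < r x" "ennreal t * emeasure lebesgue (ball x (r x)) < emeasure lebesgue (E \<inter> ball x (r x))"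
      using r x by (auto simp: Q_def)
    note rx(2)
    also have "emeasure lebesgue (E \<inter> ball x (r x)) \<le> ennreal m"
      unfolding m(1)[symmetric] by (intro emeasure_mono) auto
    finally have "ennreal (t * (\<omega> * r x ^ DIM('a))) < ennreal m"
      using rx t \<omega> by (simp add: emeasure_lebesgue_ball \<omega>_def[symmetric] ennreal_mult)
    then have "t * (\<omega> * r x ^ DIM('a)) < m" using rx t \<omega> by (subst (asm) ennreal_less_iff) auto
    then have le: "r x ^ DIM('a) \<le> m / (t * \<omega>)" using t \<omega> by (simp add: field_simps)
    have "r x \<le> max 1 (m / (t * \<omega>))"
    proof (cases "r x \<le> 1")
      case False
      then have "r x \<le> r x ^ DIM('a)" by (intro self_le_power) auto
      with le show ?thesis by simp
    qed simp
    with rx show ?thesis by simp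
  qed
  have sub: "S \<subseteq> (\<Union>x\<in>S. ball x (r x))" using rB by force
  obtain C where C: "countable C" "C \<subseteq> S"
     "pairwise (\<lambda>i j. disjnt (ball i (r i)) (ball j (r j))) C"
     "S \<subseteq> (\<Union>i\<in>C. ball i (5 * r i))"
    by (rule Vitali_covering_lemma_balls[OF sub rB])
  have "(\<integral>\<^sup>+x\<in>S. g x \<partial>lebesgue) \<le> (\<integral>\<^sup>+i. (\<integral>\<^sup>+x\<in>ball i (5 * r i). g x \<partial>lebesgue) \<partial>count_space C)"
    by (rule set_nn_integral_Union_le[OF C(1) _ g C(4)]) auto
  also have "\<dots> \<le> (\<integral>\<^sup>+i. K * (\<integral>\<^sup>+y\<in>E \<inter> ball i (r i). h y \<partial>lebesgue) \<partial>count_space C)"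
  proof (rule nn_integral_mono)
    fix i assume "i \<in> space (count_space C)"
    then have "Q i (r i)" using C(2) r by auto
    then show "(\<integral>\<^sup>+x\<in>ball i (5 * r i). g x \<partial>lebesgue) \<le> K * (\<integral>\<^sup>+y\<in>E \<inter> ball i (r i). h y \<partial>lebesgue)"
      unfolding Q_def by (intro ball) auto
  qed
  also have "\<dots> = K * (\<integral>\<^sup>+i. (\<integral>\<^sup>+y\<in>E \<inter> ball i (r i). h y \<partial>lebesgue) \<partial>count_space C)"
    by (rule nn_integral_cmult) auto
  also have "(\<integral>\<^sup>+i. (\<integral>\<^sup>+y\<in>E \<inter> ball i (r i). h y \<partial>lebesgue) \<partial>count_space C)
      = (\<integral>\<^sup>+i. emeasure (density lebesgue h) (E \<inter> ball i (r i)) \<partial>count_space C)"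
    by (intro nn_integral_cong) (simp add: emeasure_density)
  also have "\<dots> = emeasure (density lebesgue h) (\<Union>i\<in>C. E \<inter> ball i (r i))"
    by (rule nn_integral_disjoint_Union_sets[OF C(1)])
      (use C(3) in \<open>auto simp: pairwise_def disjnt_def\<close>)
  also have "\<dots> \<le> emeasure (density lebesgue h) E"
    by (rule emeasure_mono) auto
  also have "\<dots> = (\<integral>\<^sup>+y\<in>E. h y \<partial>lebesgue)" by (simp add: emeasure_density)
  finally show ?thesis unfolding S_def by (simp add: mult_left_mono)
qed

text \<open>
  The classical weak-type inequality, from the covering estimate with constant weights.
\<close>

lemma emeasure_HL_indicator_superlevel_le:
  fixes E :: "'a::euclidean_space set"
  assumes E: "E \<in> sets lebesgue" "emeasure lebesgue E < \<infinity>" and t: "0 < t"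
  shows "ennreal t * emeasure lebesgue {x. ennreal t < HL (indicator E) x} \<le> ennreal (5 ^ DIM('a)) * emeasure lebesgue E"
proof -
  define S where "S = {x. ennreal t < HL (indicator E) x}"
  have Sm: "S \<in> sets lebesgue"
    unfolding S_def using open_HL_superlevel[of "indicator E"] E by (auto intro: borel_open)
  have "(\<integral>\<^sup>+x\<in>{x. ennreal t < HL (indicator E) x}. ennreal t \<partial>lebesgue) \<le> ennreal (5 ^ DIM('a)) * (\<integral>\<^sup>+y\<in>E. 1 \<partial>lebesgue)"
  proof (rule HL_indicator_covering_estimate[OF E t])
    fix x :: 'a and r :: real
    assume r: "0 < r" and *: "ennreal t * emeasure lebesgue (ball x r) < emeasure lebesgue (E \<inter> ball x r)"
    have "(\<integral>\<^sup>+y\<in>ball x (5 * r). ennreal t \<partial>lebesgue) = ennreal t * emeasure lebesgue (ball x (5 * r))"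
      by (simp add: nn_integral_cmult_indicator)
    also have "\<dots> = ennreal (5 ^ DIM('a)) * (ennreal t * emeasure lebesgue (ball x r))"
      using r by (subst emeasure_lebesgue_ball_scale[of r 5 x x]) (auto simp: mult_ac)
    also have "\<dots> \<le> ennreal (5 ^ DIM('a)) * emeasure lebesgue (E \<inter> ball x r)"
      using * by (intro mult_left_mono) auto
    also have "emeasure lebesgue (E \<inter> ball x r) = (\<integral>\<^sup>+y\<in>E \<inter> ball x r. 1 \<partial>lebesgue)" using E by simp
    finally show "(\<integral>\<^sup>+y\<in>ball x (5 * r). ennreal t \<partial>lebesgue) \<le> ennreal (5 ^ DIM('a)) * (\<integral>\<^sup>+y\<in>E \<inter> ball x r. 1 \<partial>lebesgue)" .
  qed auto
  then show ?thesis using Sm E unfolding S_def[symmetric] by (simp add: nn_integral_cmult_indicator)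
qed

lemma emeasure_le_powr_if_exponent_integral_le_1:
  fixes p :: "'a::euclidean_space \<Rightarrow> real"
  assumes p: "AE x in lebesgue. r \<le> p x" and E: "E \<in> sets lebesgue" and l: "0 < l" "l \<le> 1"
    and E1: "(\<integral>\<^sup>+x\<in>E. ennreal (l powr - p x) \<partial>lebesgue) \<le> 1"
  shows "emeasure lebesgue E \<le> ennreal (l powr r)"
proof -
  note E [measurable]
  have "ennreal (l powr - r) * emeasure lebesgue E = (\<integral>\<^sup>+x\<in>E. ennreal (l powr - r) \<partial>lebesgue)"
    by (simp add: nn_integral_cmult_indicator)
  also have "\<dots> \<le> (\<integral>\<^sup>+x\<in>E. ennreal (l powr - p x) \<partial>lebesgue)"
  proof (rule nn_integral_mono_AE)
    show "AE x in lebesgue. ennreal (l powr - r) * indicator E x \<le> ennreal (l powr - p x) * indicator E x"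
      using p
    proof eventually_elim
      fix x assume "r \<le> p x"
      then have "l powr - r \<le> l powr - p x" using l by (intro powr_mono') auto
      then show "ennreal (l powr - r) * indicator E x \<le> ennreal (l powr - p x) * indicator E x"
        by (intro mult_right_mono ennreal_leI) auto
    qed
  qed
  also have "\<dots> \<le> ennreal 1" using E1 by simp
  finally have "emeasure lebesgue E \<le> ennreal (1 / l powr - r)"
    by (rule ennreal_le_divide_if_mult_le[rotated 2]) (use l in auto)
  also have "1 / l powr - r = l powr r" by (simp add: powr_minus_divide)
  finally show ?thesis .
qed

text \<open>
  The case \<open>L \<le> 1\<close>. A ball of radius \<open>\<rho>\<close> in which \<open>E\<close> has density above \<open>t\<close> satisfies \<open>t * \<omega> * \<rho> ^ n \<le> t * L\<close>, since the
  measure of \<open>E\<close> is at most \<open>l powr r = t * L powr r\<close>. Hence \<open>local_exponent_comparison\<close> applies on the fivefold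
  ball: there \<open>L powr - p x\<close> is comparable with its average over the part of \<open>E\<close> in the ball. The factor \<open>1 / t\<close> lost
  in passing from that part of \<open>E\<close> to the ball is regained from \<open>L powr - p y \<le> t * l powr - p y\<close>.
\<close>

lemma exponent_integral_superlevel_small:
  fixes p :: "real^'n \<Rightarrow> real"
  defines "\<omega> \<equiv> unit_ball_vol (real DIM(real^'n))"
  assumes hol: "\<And>x y. \<bar>p x - p y\<bar> \<le> c / ln (exp 1 + 1 / norm (x - y))" and c: "0 < c"
    and p: "AE x in lebesgue. r \<le> p x" and r: "1 \<le> r" and pm: "p \<in> borel_measurable lebesgue"
    and E: "E \<in> sets lebesgue" "emeasure lebesgue E < \<infinity>" and l: "0 < l" "l \<le> L" "L \<le> 1"
    and E1: "(\<integral>\<^sup>+x\<in>E. ennreal (l powr - p x) \<partial>lebesgue) \<le> 1"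
    and t: "0 < t" "(l / L) powr r = t"
  shows "(\<integral>\<^sup>+x\<in>{x. ennreal t < HL (indicator E) x}. ennreal (L powr - p x) \<partial>lebesgue)
     \<le> ennreal (5 ^ DIM(real^'n) * exp (c * (\<bar>ln \<omega>\<bar> + 6 * real DIM(real^'n))))"
proof -
  note E(1) [measurable] pm [measurable]
  define K where "K = exp (c * (\<bar>ln \<omega>\<bar> + 6 * real DIM(real^'n)))"
  have Kt: "ennreal (K * t) = ennreal K * ennreal t"
    using t by (intro ennreal_mult) (auto simp: K_def)
  have L: "0 < L" using l by simp
  have \<omega>: "0 < \<omega>" by (simp add: \<omega>_def)
  have pow: "ennreal (L powr - p y) \<le> ennreal t * ennreal (l powr - p y)" if "r \<le> p y" for y
  proof -
    have "L powr - p y = (l / L) powr p y * l powr - p y"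
      using l L by (simp add: powr_divide powr_minus field_simps)
    also have "\<dots> \<le> (l / L) powr r * l powr - p y"
      using that l L by (intro mult_right_mono powr_mono') auto
    finally show ?thesis using t by (simp add: ennreal_mult[symmetric] ennreal_leI)
  qed
  have Esmall: "emeasure lebesgue E \<le> ennreal (t * L)"
  proof -
    have "emeasure lebesgue E \<le> ennreal (l powr r)"
      by (rule emeasure_le_powr_if_exponent_integral_le_1[OF p E(1) l(1) _ E1]) (use l in simp)
    also have "l powr r = t * L powr r"
      using l L t(2)[symmetric] by (simp add: powr_divide)
    also have "L powr r \<le> L powr 1" using L l r by (intro powr_mono') auto
    then have "ennreal (t * L powr r) \<le> ennreal (t * L)"
      using t L by (intro ennreal_leI mult_left_mono) auto
    finally show ?thesis .
  qed
  have "(\<integral>\<^sup>+x\<in>{x. ennreal t < HL (indicator E) x}. ennreal (L powr - p x) \<partial>lebesgue)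
     \<le> ennreal (5 ^ DIM(real^'n) * K) * (\<integral>\<^sup>+y\<in>E. ennreal (l powr - p y) \<partial>lebesgue)"
  proof (rule HL_indicator_covering_estimate[OF E t(1)])
    fix x :: "real^'n" and \<rho> :: real
    assume \<rho>: "0 < \<rho>" and *: "ennreal t * emeasure lebesgue (ball x \<rho>) < emeasure lebesgue (E \<inter> ball x \<rho>)"
    let ?A = "E \<inter> ball x \<rho>"
    have ball_vol: "emeasure lebesgue (ball x \<rho>) = ennreal (\<omega> * \<rho> ^ DIM(real^'n))"
      unfolding \<omega>_def using \<rho> by (intro emeasure_lebesgue_ball) simp
    note *
    also have "emeasure lebesgue ?A \<le> emeasure lebesgue E" by (intro emeasure_mono) auto
    also note Esmall
    finally have "ennreal (t * (\<omega> * \<rho> ^ DIM(real^'n))) < ennreal (t * L)"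
      unfolding ball_vol using \<rho> t \<omega> by (subst ennreal_mult) auto
    then have "t * (\<omega> * \<rho> ^ DIM(real^'n)) < t * L"
      using \<rho> t \<omega> by (subst (asm) ennreal_less_iff) auto
    then have small: "\<omega> * \<rho> ^ DIM(real^'n) \<le> L" using t by simp
    define I where "I = (\<integral>\<^sup>+y\<in>?A. ennreal (l powr - p y) \<partial>lebesgue)"
    have Apos: "0 < emeasure lebesgue ?A" using * by (rule le_less_trans[rotated]) simp
    have "emeasure lebesgue ?A \<le> emeasure lebesgue E" by (intro emeasure_mono) auto
    then have Afin: "emeasure lebesgue ?A < top" using E(2) by (simp add: le_less_trans)
    have pt: "ennreal (L powr - p z) * emeasure lebesgue ?A \<le> ennreal (K * t) * I" if z: "z \<in> ball x (5 * \<rho>)" for z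
    proof -
      have "ennreal (L powr - p z) * emeasure lebesgue ?A = (\<integral>\<^sup>+y\<in>?A. ennreal (L powr - p z) \<partial>lebesgue)"
        by (simp add: nn_integral_cmult_indicator)
      also have "\<dots> \<le> (\<integral>\<^sup>+y. ennreal (K * t) * (ennreal (l powr - p y) * indicator ?A y) \<partial>lebesgue)"
      proof (rule nn_integral_mono_AE)
        show "AE y in lebesgue. ennreal (L powr - p z) * indicator ?A y
            \<le> ennreal (K * t) * (ennreal (l powr - p y) * indicator ?A y)"
          using p
        proof eventually_elim
          fix y assume py: "r \<le> p y"
          show "ennreal (L powr - p z) * indicator ?A y
            \<le> ennreal (K * t) * (ennreal (l powr - p y) * indicator ?A y)"
          proof (cases "y \<in> ?A")
            case True
            have "dist z y \<le> 6 * \<rho>"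
              using z True dist_triangle[of z y x] by (auto simp: dist_commute)
            then have "L powr - p z \<le> K * L powr - p y"
              unfolding K_def using hol c L l(3) \<omega> \<rho> small by (intro local_exponent_comparison) auto
            then have "ennreal (L powr - p z) \<le> ennreal K * ennreal (L powr - p y)"
              by (subst ennreal_mult[symmetric]) (auto simp: K_def intro: ennreal_leI)
            also have "\<dots> \<le> ennreal K * (ennreal t * ennreal (l powr - p y))"
              by (intro mult_left_mono pow py) simp
            also have "\<dots> = ennreal (K * t) * ennreal (l powr - p y)"
              unfolding Kt mult.assoc ..
            finally show ?thesis using True by simp
          qed simp
        qed
      qed
      also have "\<dots> = ennreal (K * t) * I" unfolding I_def by (rule nn_integral_cmult) measurable
      finally show ?thesis .
    qed
    have pt': "ennreal (L powr - p z) \<le> ennreal (K * t) * I / emeasure lebesgue ?A" if "z \<in> ball x (5 * \<rho>)" for z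
    proof -
      have "ennreal (L powr - p z) = ennreal (L powr - p z) * emeasure lebesgue ?A / emeasure lebesgue ?A"
        using Apos Afin by (simp add: mult_divide_eq_ennreal)
      also have "\<dots> \<le> ennreal (K * t) * I / emeasure lebesgue ?A"
        by (rule divide_right_mono_ennreal[OF pt[OF that]])
      finally show ?thesis .
    qed
    have "(\<integral>\<^sup>+z\<in>ball x (5 * \<rho>). ennreal (L powr - p z) \<partial>lebesgue)
        \<le> (\<integral>\<^sup>+z\<in>ball x (5 * \<rho>). ennreal (K * t) * I / emeasure lebesgue ?A \<partial>lebesgue)"
      by (rule nn_integral_mono) (auto simp: indicator_def intro: pt'[unfolded mem_ball])
    also have "\<dots> = ennreal (K * t) * I / emeasure lebesgue ?A * emeasure lebesgue (ball x (5 * \<rho>))"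
      by (rule nn_integral_cmult_indicator) measurable
    also have "emeasure lebesgue (ball x (5 * \<rho>)) = ennreal (5 ^ DIM(real^'n)) * emeasure lebesgue (ball x \<rho>)"
      using \<rho> by (intro emeasure_lebesgue_ball_scale) auto
    also have "ennreal (K * t) * I / emeasure lebesgue ?A * (ennreal (5 ^ DIM(real^'n)) * emeasure lebesgue (ball x \<rho>))
       = ennreal (5 ^ DIM(real^'n) * K) * I / emeasure lebesgue ?A * (ennreal t * emeasure lebesgue (ball x \<rho>))"
      using t by (simp add: ennreal_mult K_def divide_ennreal_def mult_ac)
    also have "\<dots> \<le> ennreal (5 ^ DIM(real^'n) * K) * I / emeasure lebesgue ?A * emeasure lebesgue ?A"
      using * by (intro mult_left_mono) auto
    also have "\<dots> = ennreal (5 ^ DIM(real^'n) * K) * I"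
      by (rule ennreal_divide_mult_cancel[OF Apos Afin])
    finally show "(\<integral>\<^sup>+z\<in>ball x (5 * \<rho>). ennreal (L powr - p z) \<partial>lebesgue)
      \<le> ennreal (5 ^ DIM(real^'n) * K) * (\<integral>\<^sup>+y\<in>?A. ennreal (l powr - p y) \<partial>lebesgue)" unfolding I_def .
  qed measurable
  also have "\<dots> \<le> ennreal (5 ^ DIM(real^'n) * K) * 1" by (intro mult_left_mono E1) simp
  finally show ?thesis by (simp add: K_def)
qed


text \<open>
  The case \<open>L \<ge> 1\<close>. If \<open>l \<le> 1\<close>, the measure of \<open>E\<close> is at most \<open>t * L powr r\<close>, and the weak-type inequality together with
  \<open>L powr - p x \<le> L powr - m\<close> suffices. If \<open>l > 1\<close>, then \<open>L powr - r \<le> t\<close>; the ball of radius \<open>L powr \<delta>\<close> around the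
  origin has volume \<open>\<omega> * L powr (m - r)\<close>, so \<open>L powr - m\<close> times its volume is at most \<open>\<omega> * t\<close>. This bounds both its own
  contribution and that of the part of \<open>E\<close> inside it. Outside this ball \<open>L powr - p x\<close> is comparable with a
  constant, and the weak-type inequality for Lebesgue measure transfers to the weighted measure.
\<close>

lemma exponent_integral_superlevel_large:
  fixes p :: "real^'n \<Rightarrow> real" and m r c :: real
  defines "\<omega> \<equiv> unit_ball_vol (real DIM(real^'n))"
  defines "\<delta> \<equiv> (m - r) / real DIM(real^'n)"
  defines "K \<equiv> exp (2 * c / \<delta>)"
  assumes dec: "\<And>x. \<bar>p x - pinf\<bar> \<le> c / ln (exp 1 + norm x)" and c: "0 < c"
    and p: "AE x in lebesgue. m \<le> p x" and r: "1 \<le> r" "r < m" and pm: "p \<in> borel_measurable lebesgue"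
    and E: "E \<in> sets lebesgue" "emeasure lebesgue E < \<infinity>" and l: "0 < l" "l \<le> L" "1 \<le> L"
    and E1: "(\<integral>\<^sup>+x\<in>E. ennreal (l powr - p x) \<partial>lebesgue) \<le> 1"
    and t: "0 < t" "t \<le> 1" "(l / L) powr r = t"
  shows "(\<integral>\<^sup>+x\<in>{x. ennreal t < HL (indicator E) x}. ennreal (L powr - p x) \<partial>lebesgue)
     \<le> ennreal (5 ^ DIM(real^'n) + \<omega> + 5 ^ DIM(real^'n) * K * (\<omega> + K))"
proof -
  define n where "n = DIM(real^'n)"
  have n: "0 < n" by (simp add: n_def)
  have \<omega>: "0 < \<omega>" by (simp add: \<omega>_def)
  have \<delta>: "0 < \<delta>" "real n * \<delta> = m - r" using r n unfolding \<delta>_def n_def[symmetric] by auto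
  have K: "0 < K" by (simp add: K_def)
  define S where "S = {x. ennreal t < HL (indicator E) x}"
  have Sm: "S \<in> sets lebesgue"
    unfolding S_def using open_HL_superlevel[of "indicator E"] E by (auto intro: borel_open)
  note E(1) [measurable] pm [measurable] Sm [measurable]
  have weak: "ennreal t * emeasure lebesgue S \<le> ennreal (5 ^ n) * emeasure lebesgue E"
    unfolding S_def n_def by (rule emeasure_HL_indicator_superlevel_le[OF E t(1)])
  have lLt: "l powr r = t * L powr r" using l t(3)[symmetric] by (simp add: powr_divide)
  have meas_bound: "(\<integral>\<^sup>+x\<in>A. ennreal (L powr - p x) \<partial>lebesgue) \<le> ennreal (L powr - m) * emeasure lebesgue A"
    if A: "A \<in> sets lebesgue" for A
  proof -
    have "(\<integral>\<^sup>+x\<in>A. ennreal (L powr - p x) \<partial>lebesgue) \<le> (\<integral>\<^sup>+x\<in>A. ennreal (L powr - m) \<partial>lebesgue)"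
    proof (rule nn_integral_mono_AE)
      show "AE x in lebesgue. ennreal (L powr - p x) * indicator A x \<le> ennreal (L powr - m) * indicator A x"
        using p
      proof eventually_elim
        fix x assume "m \<le> p x"
        then have "L powr - p x \<le> L powr - m" using l by (intro powr_mono) auto
        then show "ennreal (L powr - p x) * indicator A x \<le> ennreal (L powr - m) * indicator A x"
          by (intro mult_right_mono ennreal_leI) auto
      qed
    qed
    then show ?thesis using A by (simp add: nn_integral_cmult_indicator)
  qed
  have "(\<integral>\<^sup>+x\<in>S. ennreal (L powr - p x) \<partial>lebesgue) \<le> ennreal (5 ^ n + \<omega> + 5 ^ n * K * (\<omega> + K))"
  proof (cases "l \<le> 1")
    case True
    have "AE x in lebesgue. r \<le> p x" using p by eventually_elim (use r in simp)
    then have "emeasure lebesgue E \<le> ennreal (l powr r)"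
      by (rule emeasure_le_powr_if_exponent_integral_le_1[OF _ E(1) l(1) True E1])
    then have "ennreal (5 ^ n) * emeasure lebesgue E \<le> ennreal (5 ^ n) * ennreal (t * L powr r)"
      unfolding lLt by (rule mult_left_mono) simp
    also have "\<dots> = ennreal (5 ^ n * (t * L powr r))" using t by (intro ennreal_mult[symmetric]) auto
    finally have "emeasure lebesgue S \<le> ennreal (5 ^ n * (t * L powr r) / t)"
      using weak by (intro ennreal_le_divide_if_mult_le[OF t(1)]) (use t in auto)
    also have "5 ^ n * (t * L powr r) / t = 5 ^ n * L powr r" using t by simp
    finally have Sle: "emeasure lebesgue S \<le> ennreal (5 ^ n * L powr r)" .
    have "(\<integral>\<^sup>+x\<in>S. ennreal (L powr - p x) \<partial>lebesgue) \<le> ennreal (L powr - m) * ennreal (5 ^ n * L powr r)"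
      by (rule order_trans[OF meas_bound[OF Sm] mult_left_mono[OF Sle]]) simp
    also have "\<dots> = ennreal (L powr - m * (5 ^ n * L powr r))" by (intro ennreal_mult[symmetric]) auto
    also have "L powr - m * (5 ^ n * L powr r) = 5 ^ n * L powr (r - m)" by (simp add: powr_add[symmetric])
    also have "\<dots> \<le> 5 ^ n * L powr 0" using l r by (intro mult_left_mono powr_mono) auto
    also have "\<dots> \<le> 5 ^ n + \<omega> + 5 ^ n * K * (\<omega> + K)" using l \<omega> K by simp
    finally show ?thesis by (simp add: ennreal_leI)
  next
    case False
    then have l1: "1 \<le> l" by simp
    have "L powr - r \<le> t"
    proof -
      have "1 \<le> l powr r" using l1 r by (intro ge_one_powr_ge_zero) auto
      then show ?thesis using lLt l by (simp add: powr_minus field_simps)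
    qed
    define b where "b = ball (0::real^'n) (L powr \<delta>)"
    have bm [measurable]: "b \<in> sets lebesgue" by (simp add: b_def)
    have bvol: "emeasure lebesgue b = ennreal (\<omega> * (L powr \<delta>) ^ n)"
      unfolding b_def \<omega>_def n_def by (intro emeasure_lebesgue_ball) simp
    have Lb: "ennreal (L powr - m) * emeasure lebesgue b = ennreal (\<omega> * L powr - r)"
    proof -
      have "(L powr \<delta>) ^ n = L powr (m - r)"
        using l \<delta>(2) by (simp add: powr_power mult.commute)
      then have "L powr - m * (\<omega> * (L powr \<delta>) ^ n) = \<omega> * L powr - r"
        by (simp add: powr_add[symmetric])
      then show ?thesis unfolding bvol using \<omega> by (subst ennreal_mult[symmetric]) auto
    qed
    have I1: "(\<integral>\<^sup>+x\<in>b. ennreal (L powr - p x) \<partial>lebesgue) \<le> ennreal \<omega>"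
    proof -
      have "\<omega> * L powr - r \<le> \<omega> * 1"
        using \<open>L powr - r \<le> t\<close> t(2) \<omega> by (intro mult_left_mono) auto
      then have "ennreal (\<omega> * L powr - r) \<le> ennreal \<omega>" by (intro ennreal_leI) simp
      then show ?thesis using meas_bound[OF bm] unfolding Lb by (rule order_trans[rotated])
    qed
    have I2: "(\<integral>\<^sup>+x\<in>S - b. ennreal (L powr - p x) \<partial>lebesgue) \<le> ennreal (5 ^ n * K * (\<omega> + K))"
    proof (cases "\<exists>y\<in>S - b. m \<le> p y")
      case False
      have "(\<integral>\<^sup>+x\<in>S - b. ennreal (L powr - p x) \<partial>lebesgue) = (\<integral>\<^sup>+x. 0 \<partial>(lebesgue :: (real^'n) measure))"
      proof (rule nn_integral_cong_AE)
        show "AE x in lebesgue. ennreal (L powr - p x) * indicator (S - b) x = 0"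
          using p by eventually_elim (use False in \<open>auto simp: indicator_def\<close>)
      qed
      then show ?thesis by simp
    next
      case True
      then obtain y where y: "y \<in> S - b" "m \<le> p y" by blast
      have cmp: "L powr - p u \<le> K * L powr - p v" if "u \<notin> b" "v \<notin> b" for u v
        unfolding K_def using that
        by (intro global_exponent_comparison[OF dec c l(3) \<delta>(1)]) (auto simp: b_def)
      \<comment> \<open>Outside \<open>b\<close> the weight \<open>L powr - p x\<close> is comparable with its value \<open>a\<close> at the point \<open>y\<close>.\<close>
      define a where "a = L powr - p y"
      have a: "0 < a" "a \<le> L powr - m" using y l by (auto simp: a_def intro!: powr_mono)
      have Ib: "ennreal a * emeasure lebesgue (E \<inter> b) \<le> ennreal (t * \<omega>)"
      proof -
        have "ennreal a * emeasure lebesgue (E \<inter> b) \<le> ennreal (L powr - m) * emeasure lebesgue b"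
          using a by (intro mult_mono emeasure_mono ennreal_leI) auto
        also have "\<dots> \<le> ennreal (t * \<omega>)"
          unfolding Lb using \<open>L powr - r \<le> t\<close> \<omega> by (intro ennreal_leI) (simp add: mult.commute)
        finally show ?thesis .
      qed
      have Inb: "ennreal a * emeasure lebesgue (E - b) \<le> ennreal (t * K)"
      proof -
        have "ennreal a * emeasure lebesgue (E - b) = (\<integral>\<^sup>+x\<in>E - b. ennreal a \<partial>lebesgue)"
          by (simp add: nn_integral_cmult_indicator)
        also have "\<dots> \<le> (\<integral>\<^sup>+x. ennreal (t * K) * (ennreal (l powr - p x) * indicator E x) \<partial>lebesgue)"
        proof (rule nn_integral_mono_AE)
          show "AE x in lebesgue. ennreal a * indicator (E - b) x \<le> ennreal (t * K) * (ennreal (l powr - p x) * indicator E x)"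
            using p
          proof eventually_elim
            fix x assume px: "m \<le> p x"
            show "ennreal a * indicator (E - b) x \<le> ennreal (t * K) * (ennreal (l powr - p x) * indicator E x)"
            proof (cases "x \<in> E - b")
              case True
              have "a \<le> K * L powr - p x" unfolding a_def using True y by (intro cmp) auto
              also have "L powr - p x = (l / L) powr p x * l powr - p x"
                using l by (simp add: powr_divide powr_minus field_simps)
              also have "K * ((l / L) powr p x * l powr - p x) \<le> K * ((l / L) powr r * l powr - p x)"
                using K px r l by (intro mult_left_mono mult_right_mono powr_mono') auto
              finally have "a \<le> (t * K) * l powr - p x" unfolding t(3) by (simp add: mult_ac)
              then have "ennreal a \<le> ennreal (t * K) * ennreal (l powr - p x)"
                using t K by (subst ennreal_mult[symmetric]) (auto intro: ennreal_leI)
              then show ?thesis using True by simp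
            qed simp
          qed
        qed
        also have "\<dots> = ennreal (t * K) * (\<integral>\<^sup>+x\<in>E. ennreal (l powr - p x) \<partial>lebesgue)"
          by (rule nn_integral_cmult) measurable
        also have "\<dots> \<le> ennreal (t * K) * 1" by (intro mult_left_mono E1) simp
        finally show ?thesis by simp
      qed
      have "(\<integral>\<^sup>+x\<in>S - b. ennreal (L powr - p x) \<partial>lebesgue) \<le> (\<integral>\<^sup>+x\<in>S. ennreal (K * a) \<partial>lebesgue)"
      proof (rule nn_integral_mono)
        fix x show "ennreal (L powr - p x) * indicator (S - b) x \<le> ennreal (K * a) * indicator S x"
          using cmp[of x y] y by (auto simp: indicator_def a_def intro!: ennreal_leI)
      qed
      also have "\<dots> = ennreal (K * a) * emeasure lebesgue S" by (rule nn_integral_cmult_indicator[OF Sm])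
      finally have "ennreal t * (\<integral>\<^sup>+x\<in>S - b. ennreal (L powr - p x) \<partial>lebesgue)
          \<le> ennreal t * (ennreal (K * a) * emeasure lebesgue S)" by (rule mult_left_mono) simp
      also have "\<dots> = ennreal (K * a) * (ennreal t * emeasure lebesgue S)" by (simp add: mult_ac)
      also have "\<dots> \<le> ennreal (K * a) * (ennreal (5 ^ n) * emeasure lebesgue E)"
        by (rule mult_left_mono[OF weak]) simp
      also have "emeasure lebesgue E = emeasure lebesgue (E \<inter> b) + emeasure lebesgue (E - b)"
        by (subst plus_emeasure) (auto intro!: arg_cong[where f = "emeasure lebesgue"])
      also have "ennreal (K * a) * (ennreal (5 ^ n) * (emeasure lebesgue (E \<inter> b) + emeasure lebesgue (E - b)))
         = ennreal (5 ^ n * K) * (ennreal a * emeasure lebesgue (E \<inter> b) + ennreal a * emeasure lebesgue (E - b))"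
        using K a by (simp add: ennreal_mult distrib_left mult_ac)
      also have "\<dots> \<le> ennreal (5 ^ n * K) * (ennreal (t * \<omega>) + ennreal (t * K))"
        by (intro mult_left_mono add_mono Ib Inb) simp
      also have "\<dots> = ennreal (5 ^ n * K * (t * \<omega> + t * K))"
        using t K \<omega> by (simp add: ennreal_mult)
      also have "5 ^ n * K * (t * \<omega> + t * K) = t * (5 ^ n * K * (\<omega> + K))" by (simp add: algebra_simps)
      finally have "(\<integral>\<^sup>+x\<in>S - b. ennreal (L powr - p x) \<partial>lebesgue) \<le> ennreal (t * (5 ^ n * K * (\<omega> + K)) / t)"
        by (rule ennreal_le_divide_if_mult_le[rotated 2]) (use t K \<omega> in auto)
      then show ?thesis using t by simp
    qed
    have "(\<integral>\<^sup>+x\<in>S. ennreal (L powr - p x) \<partial>lebesgue)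
        \<le> (\<integral>\<^sup>+x. ennreal (L powr - p x) * indicator b x + ennreal (L powr - p x) * indicator (S - b) x \<partial>lebesgue)"
      by (rule nn_integral_mono) (auto simp: indicator_def)
    also have "\<dots> = (\<integral>\<^sup>+x\<in>b. ennreal (L powr - p x) \<partial>lebesgue) + (\<integral>\<^sup>+x\<in>S - b. ennreal (L powr - p x) \<partial>lebesgue)"
      by (rule nn_integral_add) measurable
    also have "\<dots> \<le> ennreal \<omega> + ennreal (5 ^ n * K * (\<omega> + K))" by (rule add_mono[OF I1 I2])
    also have "\<dots> = ennreal (\<omega> + 5 ^ n * K * (\<omega> + K))" using \<omega> K by (intro ennreal_plus[symmetric]) auto
    also have "\<dots> \<le> ennreal (5 ^ n + \<omega> + 5 ^ n * K * (\<omega> + K))" by (intro ennreal_leI) simp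
    finally show ?thesis .
  qed
  then show ?thesis unfolding S_def n_def .
qed

text \<open>
  The restricted weak-type estimate that a maximal operator bounded on \<open>Lp\<close> with exponent \<open>p / r\<close> would give. The
  scaling \<open>L = l * t powr (- 1 / r)\<close> is chosen so that \<open>(l / L) powr r = t\<close>.
\<close>

lemma log_Holder_restricted_weak_type:
  fixes p :: "real^'n \<Rightarrow> real"
  assumes lH: "log_Holder p" and p: "AE x in lebesgue. m \<le> p x" and r: "1 < r" "r < m"
    and pm: "p \<in> borel_measurable lebesgue"
  shows "\<exists>C\<ge>1. \<forall>E t. E \<in> sets lebesgue \<longrightarrow> 0 < t \<longrightarrow> t \<le> 1 \<longrightarrow>
    Lp_norm p (indicator {x. ennreal t < HL (indicator E) x}) \<le> ennreal (C * t powr (- 1 / r)) * Lp_norm p (indicator E)"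
proof -
  obtain c c' pinf where c: "0 < c" and c': "0 < c'"
    and hol: "\<And>x y. \<bar>p x - p y\<bar> \<le> c / ln (exp 1 + 1 / norm (x - y))"
    and dec: "\<And>x. \<bar>p x - pinf\<bar> \<le> c' / ln (exp 1 + norm x)"
    using lH unfolding log_Holder_def by blast
  have P: "p x \<le> \<bar>pinf\<bar> + c'" for x
  proof -
    have "ln (exp (1::real)) \<le> ln (exp 1 + norm x)" by (intro ln_mono) (auto intro!: add_pos_nonneg)
    then have "c' / ln (exp 1 + norm x) \<le> c' / 1" using c' by (intro divide_left_mono) auto
    then show ?thesis using dec[of x] by simp
  qed
  have p1: "AE x in lebesgue. 1 \<le> p x" and pr: "AE x in lebesgue. r \<le> p x"
    using p r by (auto elim!: eventually_mono)
  define \<omega> where "\<omega> = unit_ball_vol (real DIM(real^'n))"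
  define \<delta> where "\<delta> = (m - r) / real DIM(real^'n)"
  define K where "K = exp (2 * c' / \<delta>)"
  define C1 where "C1 = 5 ^ DIM(real^'n) * exp (c * (\<bar>ln \<omega>\<bar> + 6 * real DIM(real^'n)))"
  define C2 where "C2 = 5 ^ DIM(real^'n) + \<omega> + 5 ^ DIM(real^'n) * K * (\<omega> + K)"
  define C where "C = max 1 (max C1 C2)"
  have C: "1 \<le> C" "C1 \<le> C" "C2 \<le> C" by (auto simp: C_def)
  show ?thesis
  proof (intro exI[of _ C] conjI allI impI)
    fix E :: "(real^'n) set" and t :: real
    assume E: "E \<in> sets lebesgue" and t: "0 < t" "t \<le> 1"
    define S where "S = {x. ennreal t < HL (indicator E) x}"
    have Sm: "S \<in> sets lebesgue"
      unfolding S_def using open_HL_superlevel[of "indicator E"] E by (auto intro: borel_open)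
    define B where "B = C * t powr (- 1 / r)"
    have B: "0 < B" using C t by (simp add: B_def)
    have bd: "Lp_norm p (indicator S) \<le> ennreal (B * l)"
      if l: "0 < l" "(\<integral>\<^sup>+x\<in>E. ennreal (l powr - p x) \<partial>lebesgue) \<le> 1" for l
    proof -
      define L where "L = l * t powr (- 1 / r)"
      have "t powr 0 \<le> t powr (- 1 / r)" using t r by (intro powr_mono') auto
      then have tr: "1 \<le> t powr (- 1 / r)" using t by simp
      have L: "0 < L" "l \<le> L" using l t tr by (auto simp: L_def)
      have tL: "(l / L) powr r = t"
      proof -
        have "l / L = t powr (1 / r)" using l t by (simp add: L_def powr_minus field_simps)
        then show ?thesis using t r by (simp add: powr_powr)
      qed
      have "emeasure lebesgue E \<le> ennreal (max 1 l powr (\<bar>pinf\<bar> + c')) * (\<integral>\<^sup>+x\<in>E. ennreal (l powr - p x) \<partial>lebesgue)"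
        by (rule emeasure_le_exponent_integral[OF p1 pm P E l(1)])
      also have "\<dots> \<le> ennreal (max 1 l powr (\<bar>pinf\<bar> + c')) * 1" by (intro mult_left_mono l(2)) simp
      also have "\<dots> < \<infinity>" by simp
      finally have Efin: "emeasure lebesgue E < \<infinity>" .
      have "(\<integral>\<^sup>+x\<in>S. ennreal (L powr - p x) \<partial>lebesgue) \<le> ennreal C"
      proof (cases "L \<le> 1")
        case True
        have "(\<integral>\<^sup>+x\<in>S. ennreal (L powr - p x) \<partial>lebesgue) \<le> ennreal C1"
          unfolding S_def C1_def \<omega>_def
          by (rule exponent_integral_superlevel_small[OF hol c pr _ pm E Efin l(1) L(2) True l(2) t(1) tL]) (use r in simp)
        then show ?thesis using C by (meson ennreal_leI order_trans)
      next
        case False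
        have "(\<integral>\<^sup>+x\<in>S. ennreal (L powr - p x) \<partial>lebesgue) \<le> ennreal C2"
          unfolding S_def C2_def K_def \<delta>_def \<omega>_def
          by (rule exponent_integral_superlevel_large[OF dec c' p _ r(2) pm E Efin l(1) L(2) _ l(2) t tL]) (use r False in simp_all)
        then show ?thesis using C by (meson ennreal_leI order_trans)
      qed
      then have "Lp_norm p (indicator S) \<le> ennreal (C * L)"
        by (rule Lp_norm_indicator_le_mult[OF p1 L(1) C(1) _ pm Sm])
      then show ?thesis by (simp add: B_def L_def mult_ac)
    qed
    have "ennreal (1 / B) * Lp_norm p (indicator S) \<le> Lp_norm p (indicator E)"
    proof (rule dense_ge)
      fix a assume "Lp_norm p (indicator E) < a"
      then obtain l where l: "0 < l" "ennreal l < a" "(\<integral>\<^sup>+x\<in>E. ennreal (l powr - p x) \<partial>lebesgue) \<le> 1"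
        by (rule Lp_norm_indicator_lessE)
      have "ennreal (1 / B) * Lp_norm p (indicator S) \<le> ennreal (1 / B) * ennreal (B * l)"
        by (intro mult_left_mono bd l) simp
      also have "\<dots> = ennreal l" using B l by (simp add: ennreal_mult[symmetric])
      finally show "ennreal (1 / B) * Lp_norm p (indicator S) \<le> a" using l(2) by simp
    qed
    then have "ennreal B * (ennreal (1 / B) * Lp_norm p (indicator S)) \<le> ennreal B * Lp_norm p (indicator E)"
      by (rule mult_left_mono) simp
    moreover have "ennreal B * (ennreal (1 / B) * Lp_norm p (indicator S)) = Lp_norm p (indicator S)"
      using B by (simp add: mult.assoc[symmetric] ennreal_mult[symmetric])
    ultimately show "Lp_norm p (indicator {x. ennreal t < HL (indicator E) x})
      \<le> ennreal (C * t powr (- 1 / r)) * Lp_norm p (indicator E)" unfolding S_def B_def by simp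
  qed (rule C(1))
qed

text \<open>
  Relative to \<open>2 ^ k\<close>, the left side decays like \<open>2 powr ((s - 1) * k)\<close> up to polynomial factors. Writing the ratio
  \<open>2 powr (s - 1)\<close> as a fourth power \<open>y ^ 4\<close> reduces the claim to boundedness of \<open>n * y ^ n\<close>.
\<close>

lemma geometric_weight_powr_le:
  assumes s: "0 < s" "s < (1::real)"
  shows "\<exists>M\<ge>0. \<forall>k::nat. (2 ^ Suc k * (real (Suc k) * real (k + 2))) powr s \<le> M * 2 ^ k / real (Suc k) ^ 2"
proof -
  define y where "y = 2 powr ((s - 1) / 4)"
  have y: "0 < y" "y < 1" using s by (auto simp: y_def powr_less_one)
  have "(\<lambda>n. real n * y ^ n) \<longlonglongrightarrow> 0" using powser_times_n_limit_0[of y] y by simp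
  then have "Bseq (\<lambda>n. real n * y ^ n)" using convergentI convergent_imp_Bseq by blast
  then obtain M where M: "0 < M" "\<And>n. norm (real n * y ^ n) \<le> M" by (auto elim: BseqE)
  show ?thesis
  proof (intro exI[of _ "32 * M ^ 4"] conjI allI)
    show "0 \<le> 32 * M ^ 4" using M by simp
    fix k :: nat
    have "real (Suc k) * y ^ Suc k \<le> M" using M(2)[of "Suc k"] y by simp
    moreover have "real (k + 2) * y ^ Suc k \<le> 2 * (real (Suc k) * y ^ Suc k)"
      using y mult_right_mono[of "real (k + 2)" "2 * real (Suc k)" "y ^ Suc k"] by simp
    ultimately have "real (k + 2) * y ^ Suc k \<le> 2 * M" by linarith
    then have "(real (k + 2) * y ^ Suc k) ^ 4 \<le> (2 * M) ^ 4" using y by (intro power_mono) auto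
    then have b4: "real (k + 2) ^ 4 * (y ^ 4) ^ Suc k \<le> 16 * M ^ 4"
      by (simp add: power_mult_distrib power_mult[symmetric] mult.commute)
    have y4: "y ^ 4 = 2 powr (s - 1)" by (simp add: y_def powr_power diff_divide_distrib)
    have pw: "(2 ^ Suc k) powr s = 2 ^ Suc k * (y ^ 4) ^ Suc k"
    proof -
      have "(2 ^ Suc k) powr s = 2 powr (real (Suc k) * s)" by (simp add: powr_realpow[symmetric] powr_powr del: power_Suc)
      also have "\<dots> = 2 powr real (Suc k) * 2 powr (real (Suc k) * (s - 1))"
        by (simp add: powr_add[symmetric] algebra_simps)
      also have "2 powr (real (Suc k) * (s - 1)) = (2 powr (s - 1)) ^ Suc k"
        by (simp add: powr_power mult.commute del: power_Suc)
      also have "2 powr real (Suc k) = 2 ^ Suc k" by (rule powr_realpow) simp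
      finally show ?thesis unfolding y4 .
    qed
    have "(real (Suc k) * real (k + 2)) powr s \<le> (real (Suc k) * real (k + 2)) powr 1"
      using s mult_mono[of 1 "real (Suc k)" 1 "real (k + 2)"] by (intro powr_mono) auto
    also have "\<dots> \<le> real (k + 2) ^ 2" by (simp add: power2_eq_square)
    finally have "(2 ^ Suc k * (real (Suc k) * real (k + 2))) powr s \<le> (2 ^ Suc k * (y ^ 4) ^ Suc k) * real (k + 2) ^ 2"
      using y unfolding powr_mult pw[symmetric] by (simp add: powr_mult mult_left_mono)
    then have "(2 ^ Suc k * (real (Suc k) * real (k + 2))) powr s * real (Suc k) ^ 2
        \<le> ((2 ^ Suc k * (y ^ 4) ^ Suc k) * real (k + 2) ^ 2) * real (k + 2) ^ 2"
      using y by (intro mult_mono power_mono) auto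
    also have "\<dots> = 2 ^ Suc k * (real (k + 2) ^ 4 * (y ^ 4) ^ Suc k)"
      by (simp add: power4_eq_xxxx power2_eq_square mult_ac)
    also have "\<dots> \<le> 2 ^ Suc k * (16 * M ^ 4)" by (rule mult_left_mono[OF b4]) simp
    finally show "(2 ^ Suc k * (real (Suc k) * real (k + 2))) powr s \<le> 32 * M ^ 4 * 2 ^ k / real (Suc k) ^ 2"
      by (simp add: le_divide_eq mult_ac)
  qed
qed

lemma bounded_weak_Lp_if_log_Holder:
  fixes p :: "real^'n \<Rightarrow> real"
  assumes lH: "log_Holder p" and p: "AE x in lebesgue. m \<le> p x" "1 < m"
    and pm: "p \<in> borel_measurable lebesgue"
  shows "bounded_operator_on (weak_Lp p) (weak_Lp_norm p) maximal_op"
proof -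
  obtain r where r: "1 < r" "r < m" using dense[OF p(2)] by blast
  have p1: "AE x in lebesgue. 1 \<le> p x" using p(1) by eventually_elim (use p(2) in simp)
  obtain C where C: "1 \<le> C" and restr: "\<And>E t. E \<in> sets lebesgue \<Longrightarrow> 0 < t \<Longrightarrow> t \<le> 1 \<Longrightarrow>
    Lp_norm p (indicator {x. ennreal t < HL (indicator E) x}) \<le> ennreal (C * t powr (- 1 / r)) * Lp_norm p (indicator E)"
    using log_Holder_restricted_weak_type[OF lH p(1) r pm] by blast
  obtain M where M: "0 \<le> M" "\<And>k::nat. (2 ^ Suc k * (real (Suc k) * real (k + 2))) powr (1 / r) \<le> M * 2 ^ k / real (Suc k) ^ 2"
    using geometric_weight_powr_le[of "1 / r"] r by auto
  show ?thesis
  proof (rule bounded_weak_Lp_if_restricted[OF p1 pm, of 2 "C * M"])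
    show "0 \<le> C * M" using C M by simp
    fix E :: "(real^'n) set" and k :: nat
    assume E: "E \<in> sets lebesgue"
    define w where "w = 2 ^ Suc k * (real (Suc k) * real (k + 2))"
    have "(1::real) \<le> 2 ^ Suc k" by (rule one_le_power) simp
    then have "1 * (1 * 1) \<le> w" unfolding w_def by (intro mult_mono) auto
    then have w: "1 \<le> w" by simp
    have "Lp_norm p (indicator {x. ennreal (1 / w) < HL (indicator E) x})
        \<le> ennreal (C * (1 / w) powr (- 1 / r)) * Lp_norm p (indicator E)"
      by (rule restr[OF E]) (use w in auto)
    also have "(1 / w) powr (- 1 / r) = w powr (1 / r)"
      using w by (simp add: powr_divide powr_minus)
    also have "ennreal (C * w powr (1 / r)) * Lp_norm p (indicator E)
        \<le> ennreal (C * M * 2 ^ k / real (Suc k) ^ 2) * Lp_norm p (indicator E)"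
    proof (intro mult_right_mono ennreal_leI)
      have "C * w powr (1 / r) \<le> C * (M * 2 ^ k / real (Suc k) ^ 2)"
        using C M(2)[of k] by (intro mult_left_mono) (auto simp: w_def)
      then show "C * w powr (1 / r) \<le> C * M * 2 ^ k / real (Suc k) ^ 2" by simp
    qed simp
    finally show "Lp_norm p (indicator {x. ennreal (1 / (2 ^ Suc k * (real (Suc k) * real (k + 2)))) < HL (indicator E) x})
        \<le> ennreal (C * M * 2 ^ k / real (Suc k) ^ 2) * Lp_norm p (indicator E)" unfolding w_def .
  qed simp
qed

section \<open>Boundedness on weak Lebesgue spaces\<close>

text \<open>
  Measurability of \<open>p\<close> comes for free, as the essential supremum of a non-measurable function is \<open>\<infinity>\<close> by
  convention.
\<close>

lemma p_minus_gt_1D: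
  fixes p :: "real^'n \<Rightarrow> real"
  assumes "p_minus p > 1"
  shows "p \<in> borel_measurable lebesgue" "\<exists>m>1. AE x in lebesgue. m \<le> p x"
proof -
  have m: "(\<lambda>x. - ereal (p x)) \<in> borel_measurable lebesgue"
  proof (rule ccontr)
    assume "\<not> ?thesis"
    then have "esssup lebesgue (\<lambda>x. - ereal (p x)) = top" by (rule esssup_non_measurable)
    then show False using assms by (simp add: p_minus_def top_ereal_def)
  qed
  then have "(\<lambda>x. real_of_ereal (- (- ereal (p x)))) \<in> borel_measurable lebesgue" by measurable
  then show "p \<in> borel_measurable lebesgue" by simp
  obtain m where m: "1 < m" "ereal m < p_minus p"
    using ereal_dense2[OF assms] by (auto simp: one_ereal_def)
  have "AE x in lebesgue. - ereal (p x) \<le> esssup lebesgue (\<lambda>x. - ereal (p x))" by (rule esssup_AE)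
  then have "AE x in lebesgue. m \<le> p x"
  proof eventually_elim
    fix x assume "- ereal (p x) \<le> esssup lebesgue (\<lambda>x. - ereal (p x))"
    then have "p_minus p \<le> ereal (p x)" unfolding p_minus_def by (simp add: ereal_uminus_le_reorder)
    with m(2) have "ereal m < ereal (p x)" by (rule less_le_trans)
    then show "m \<le> p x" by simp
  qed
  with m(1) show "\<exists>m>1. AE x in lebesgue. m \<le> p x" by blast
qed

theorem theorem1p3:
  fixes p :: "real^'n \<Rightarrow> real"
  assumes "p_minus p > 1"
  shows "(p \<in> borel_measurable lebesgue \<and> bounded (range p) \<and>
            bounded_operator_on (Lp p) (Lp_norm p) maximal_op
          \<longrightarrow> bounded_operator_on (weak_Lp p) (weak_Lp_norm p) maximal_op) \<and>
         (log_Holder p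
          \<longrightarrow> bounded_operator_on (weak_Lp p) (weak_Lp_norm p) maximal_op)"
proof (intro conjI impI)
  note pm = p_minus_gt_1D(1)[OF assms]
  obtain m where m: "1 < m" "AE x in lebesgue. m \<le> p x" using p_minus_gt_1D(2)[OF assms] by blast
  have p1: "AE x in lebesgue. 1 \<le> p x" using m(2) by eventually_elim (use m(1) in simp)
  {
    assume *: "p \<in> borel_measurable lebesgue \<and> bounded (range p) \<and>
      bounded_operator_on (Lp p) (Lp_norm p) maximal_op"
    then obtain P where "\<And>x. norm (p x) \<le> P" by (auto simp: bounded_iff)
    then have "p x \<le> P" for x by (smt (verit) real_norm_def)
    then show "bounded_operator_on (weak_Lp p) (weak_Lp_norm p) maximal_op"
      using bounded_weak_Lp_if_bounded_Lp[OF p1 pm] * by blast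
  next
    assume "log_Holder p"
    then show "bounded_operator_on (weak_Lp p) (weak_Lp_norm p) maximal_op"
      by (rule bounded_weak_Lp_if_log_Holder[OF _ m(2,1) pm])
  }
qed

end
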